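(* Let $\pi\vdash\Gamma$ be an LK-proof of a sequent $\Gamma=\exists\vec v_0A_0,\dots,\exists\vec v_kA_k$ of prenex $\Sigma_1$ formulas ($A_i$ quantifier-free) in which all cuts are on prenex $\Pi_2$ and $\Sigma_2$ formulas. Then the expansion of $\Gamma$ induced by $L(\pi)$, i.e. the sequent obtained by replacing each $\exists\vec v_iA_i$ by $\bigvee\{A_i(\vec t)\mid (i,\vec t)\in L(\pi)\}$, is a tautology.
   Context: One-sided LK: formulas in negation normal form, $\bar A$ the dual, sequents finite sequences, $\lvert\Gamma\rvert$ the length. Axioms $\bar A,A$ ($A$ atomic); rules $\lor,\land,\forall$ (eigenvariable), $\exists$, cut, weakening, contraction, permutation. All formulas are prenex $\Pi_2$/$\Sigma_2$; proofs are regular (each strong quantifier inference has a unique eigenvariable). Types: $o$ = structured first-order terms (first-order terms closed under explicit substitution $s[\alpha\mapsto t]$), $\epsilon$ unit type with element $\langle\rangle$; closed under $\times$ (pairs $u\star u'$) and $\to$. $o^0=\epsilon$, $o^{k+1}=o\times o^k$, $\langle u_0,\dots,u_{k-1}\rangle=u_0\star\cdots\star u_{k-1}\star\langle\rangle$. For $F=\forall^m\exists^n G$ ($G$ quantifier-free): $\tau_F=o^n,\tau^*_F=o^m$; for $F=\exists^m\forall^nG$, $n>0$: $\tau_F=o^m$, $\tau^*_F=o\to\cdots\to o\to o^n$ ($m$ arguments). Grammar: for each subproof $\rho\vdash A_0,\dots,A_n$ and $i\le n$ a non-terminal $\sigma^i_\rho:\tau^*_{A_0}\to\cdots\to\tau^*_{A_n}\to\tau_{A_i}$,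 with production rules by the last inference of $\rho$: axiom $\rho\vdash\bar A,A$: $\sigma^i_\rho z_0z_1\to z_{1-i}$. $\forall$ ($\rho\vdash\forall vA,\Gamma$ from $\rho_0\vdash A(v/\alpha),\Gamma$): $\sigma^i_\rho(z_0\star z_1)\vec y\to(\sigma^i_{\rho_0}z_1\vec y)[\alpha\mapsto z_0]$. $\exists$ ($\rho\vdash\exists vA,\Gamma$ from $\rho_0\vdash A(v/r),\Gamma$): $\sigma^0_\rho z\vec y\to r\star\sigma^0_{\rho_0}(z\cdot r)\vec y$, $\sigma^i_\rho z\vec y\to\sigma^i_{\rho_0}(z\cdot r)\vec y$ ($i>0$), with $z\cdot r=z$ if $z:\epsilon$, else $zr$. Cut ($\rho\vdash\Gamma,\Delta$ from $\rho_0\vdash A,\Gamma$, $\rho_1\vdash\bar A,\Delta$; $\vec x,\vec y$ of lengths $\lvert\Gamma\rvert,\lvert\Delta\rvert$): $\sigma^i_\rho\vec x\vec y\to\sigma^{i+1}_{\rho_0}((\sigma^0_{\rho_1}\circ_{\bar A}\sigma^0_{\rho_0})\vec y\vec x)\vec x$ for $i<\lvert\Gamma\rvert$, and $\sigma^i_\rho\vec x\vec y\to\sigma^{i-\lvert\Gamma\rvert+1}_{\rho_1}((\sigma^0_{\rho_0}\circ_A\sigma^0_{\rho_1})\vec x\vec y)\vec y$ otherwise; where for $\theta_0\vdash F,\Gamma'$, $\theta_1\vdash\bar F,\Delta'$, $(\sigma^0_{\theta_0}\circ_F\sigma^0_{\theta_1})\vec x\vec y$ equals $\langle\rangle$ ($F$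 quantifier-free), $\lambda z_0\cdots z_m.\sigma^0_{\theta_0}\langle z_0..z_m\rangle\vec x$ ($F=\forall v_0\cdots\forall v_mG$, $G\in\Sigma_1$), or $\sigma^0_{\theta_0}(\lambda z_0\cdots z_m.\sigma^0_{\theta_1}\langle z_0..z_m\rangle\vec y)\vec x$ ($F=\exists v_0\cdots\exists v_mG$, $G\in\Pi_1$). Contraction ($\rho\vdash A,\Gamma$ from $\rho_0\vdash A,A,\Gamma$): $\sigma^0_\rho z\vec y\to\sigma^0_{\rho_0}zz\vec y\mid\sigma^1_{\rho_0}zz\vec y$, $\sigma^i_\rho z\vec y\to\sigma^{i+1}_{\rho_0}zz\vec y$ ($i>0$). Weakening ($\rho\vdash A,\Gamma$ from $\rho_0\vdash\Gamma$): $\sigma^0_\rho z\vec y\to\langle\mathsf c,\dots,\mathsf c\rangle$ (one fixed constant per existential quantifier of $A$), $\sigma^i_\rho z\vec y\to\sigma^{i-1}_{\rho_0}\vec y$. Permutation ($\rho\vdash\Gamma,A,B,\Delta$ from $\rho_0\vdash\Gamma,B,A,\Delta$): $\sigma^i_\rho\vec xz_0z_1\vec y\to\sigma^j_{\rho_0}\vec xz_1z_0\vec y$, $j$ the index of the $i$-th formula after swapping. Language: derivations apply production rules and $\beta$-reductions. For $\pi\vdash\exists\vec v_0A_0,\dots,\exists\vec v_kA_k$ ($\exists\vec v_i$ a block of length $a_i$), $L(\pi)$ is the set of pairs $(i,T^* )$, $i\le k$, where $T:o^{a_i}$ is a non-terminal-free sequence-term derivable from $\sigma^i_\pi\langle\rangle\cdots\langle\rangle$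 and $T^*$ is the result of evaluating all explicit substitutions in $T$.
   Formalization: Regularity here also requires that each eigenvariable occurs in the proof only above its inference (mere uniqueness makes the claim false); for cuts on Π1/Σ1 formulas the ill-typed λ-term in the composition is read as ⟨⟩; explicit substitutions act componentwise on sequences. *)

theory Defs
  imports Main
begin

section \<open>Terms and formulas in negation normal form\<close>

text \<open>Locally nameless syntax: \<open>Free\<close> are the free variables (among them the eigenvariables),
  \<open>Bound\<close> are de Bruijn indices pointing to quantifiers. A function symbol may be used with any
  number of arguments; \<open>Fn c []\<close> is a constant.\<close>

datatype 'f tm = Free nat | Bound nat | Fn 'f "'f tm list"

datatype ('f, 'p) fm =
    Lit bool 'p "'f tm list"  \<comment> \<open>\<open>Lit True p ts\<close> is the atom, \<open>Lit False p ts\<close> its negation\<close>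
  | And "('f, 'p) fm" "('f, 'p) fm"
  | Or "('f, 'p) fm" "('f, 'p) fm"
  | Forall "('f, 'p) fm"
  | Exists "('f, 'p) fm"

primrec dual :: "('f, 'p) fm \<Rightarrow> ('f, 'p) fm" where
  "dual (Lit b p ts) = Lit (\<not> b) p ts"
| "dual (And A B) = Or (dual A) (dual B)"
| "dual (Or A B) = And (dual A) (dual B)"
| "dual (Forall A) = Exists (dual A)"
| "dual (Exists A) = Forall (dual A)"

fun fv_tm :: "'f tm \<Rightarrow> nat set" where
  "fv_tm (Free a) = {a}"
| "fv_tm (Bound i) = {}"
| "fv_tm (Fn f ts) = (\<Union>t\<in>set ts. fv_tm t)"

primrec fv :: "('f, 'p) fm \<Rightarrow> nat set" where
  "fv (Lit b p ts) = (\<Union>t\<in>set ts. fv_tm t)"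
| "fv (And A B) = fv A \<union> fv B"
| "fv (Or A B) = fv A \<union> fv B"
| "fv (Forall A) = fv A"
| "fv (Exists A) = fv A"

text \<open>All dangling indices are below \<open>k\<close>; proper terms and formulas are those with \<open>k = 0\<close>.\<close>

fun wf_tm :: "nat \<Rightarrow> 'f tm \<Rightarrow> bool" where
  "wf_tm k (Free a) = True"
| "wf_tm k (Bound i) = (i < k)"
| "wf_tm k (Fn f ts) = (\<forall>t\<in>set ts. wf_tm k t)"

primrec wf_fm :: "nat \<Rightarrow> ('f, 'p) fm \<Rightarrow> bool" where
  "wf_fm k (Lit b p ts) = (\<forall>t\<in>set ts. wf_tm k t)"
| "wf_fm k (And A B) = (wf_fm k A \<and> wf_fm k B)"
| "wf_fm k (Or A B) = (wf_fm k A \<and> wf_fm k B)"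
| "wf_fm k (Forall A) = wf_fm (Suc k) A"
| "wf_fm k (Exists A) = wf_fm (Suc k) A"

text \<open>\<open>inst 0 r A\<close> is \<open>A(v/r)\<close> for the body \<open>A\<close> of a quantified formula binding \<open>v\<close>.\<close>

primrec inst_tm :: "nat \<Rightarrow> 'f tm \<Rightarrow> 'f tm \<Rightarrow> 'f tm" where
  "inst_tm k r (Free a) = Free a"
| "inst_tm k r (Bound i) = (if i = k then r else Bound i)"
| "inst_tm k r (Fn f ts) = Fn f (map (inst_tm k r) ts)"

primrec inst :: "nat \<Rightarrow> 'f tm \<Rightarrow> ('f, 'p) fm \<Rightarrow> ('f, 'p) fm" where
  "inst k r (Lit b p ts) = Lit b p (map (inst_tm k r) ts)"
| "inst k r (And A B) = And (inst k r A) (inst k r B)"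
| "inst k r (Or A B) = Or (inst k r A) (inst k r B)"
| "inst k r (Forall A) = Forall (inst (Suc k) r A)"
| "inst k r (Exists A) = Exists (inst (Suc k) r A)"

primrec subst_tm :: "nat \<Rightarrow> 'f tm \<Rightarrow> 'f tm \<Rightarrow> 'f tm" where
  "subst_tm a r (Free b) = (if b = a then r else Free b)"
| "subst_tm a r (Bound i) = Bound i"
| "subst_tm a r (Fn f ts) = Fn f (map (subst_tm a r) ts)"

primrec qfree :: "('f, 'p) fm \<Rightarrow> bool" where
  "qfree (Lit b p ts) = True"
| "qfree (And A B) = (qfree A \<and> qfree B)"
| "qfree (Or A B) = (qfree A \<and> qfree B)"
| "qfree (Forall A) = False"
| "qfree (Exists A) = False"

definition sigma1 :: "('f, 'p) fm \<Rightarrow> bool" where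
  "sigma1 F \<longleftrightarrow> (\<exists>n G. qfree G \<and> F = (Exists ^^ n) G)"

definition pi2 :: "('f, 'p) fm \<Rightarrow> bool" where
  "pi2 F \<longleftrightarrow> (\<exists>m n G. qfree G \<and> F = (Forall ^^ m) ((Exists ^^ n) G))"

definition sigma2 :: "('f, 'p) fm \<Rightarrow> bool" where
  "sigma2 F \<longleftrightarrow> (\<exists>m n G. qfree G \<and> F = (Exists ^^ m) ((Forall ^^ n) G))"


section \<open>One-sided LK\<close>

text \<open>Proof trees carry just enough data to determine their end-sequent.\<close>

datatype ('f, 'p) lkproof =
    Ax 'p "'f tm list"
  | OrI "('f, 'p) lkproof"
  | AndI "('f, 'p) lkproof" "('f, 'p) lkproof"
  | AllI nat "('f, 'p) fm" "('f, 'p) lkproof"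
  | ExI "('f, 'p) fm" "'f tm" "('f, 'p) lkproof"
  | Cut "('f, 'p) fm" "('f, 'p) lkproof" "('f, 'p) lkproof"
  | Weak "('f, 'p) fm" "('f, 'p) lkproof"
  | Contr "('f, 'p) lkproof"
  | Perm nat "('f, 'p) lkproof"

inductive proves :: "('f, 'p) lkproof \<Rightarrow> ('f, 'p) fm list \<Rightarrow> bool" (infix "\<turnstile>" 50) where
  Ax: "\<forall>t\<in>set ts. wf_tm 0 t \<Longrightarrow> Ax p ts \<turnstile> [Lit False p ts, Lit True p ts]"
| OrI: "\<rho> \<turnstile> A # B # \<Gamma> \<Longrightarrow> OrI \<rho> \<turnstile> Or A B # \<Gamma>"
| AndI: "\<rho>\<^sub>0 \<turnstile> A # \<Gamma> \<Longrightarrow> \<rho>\<^sub>1 \<turnstile> B # \<Delta> \<Longrightarrow> AndI \<rho>\<^sub>0 \<rho>\<^sub>1 \<turnstile> And A B # \<Gamma> @ \<Delta>"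
| AllI: "\<rho> \<turnstile> inst 0 (Free \<alpha>) A # \<Gamma> \<Longrightarrow> \<alpha> \<notin> fv A \<Longrightarrow> \<forall>B\<in>set \<Gamma>. \<alpha> \<notin> fv B \<Longrightarrow>
    AllI \<alpha> A \<rho> \<turnstile> Forall A # \<Gamma>"
| ExI: "\<rho> \<turnstile> inst 0 r A # \<Gamma> \<Longrightarrow> wf_tm 0 r \<Longrightarrow> ExI A r \<rho> \<turnstile> Exists A # \<Gamma>"
| Cut: "\<rho>\<^sub>0 \<turnstile> A # \<Gamma> \<Longrightarrow> \<rho>\<^sub>1 \<turnstile> dual A # \<Delta> \<Longrightarrow> Cut A \<rho>\<^sub>0 \<rho>\<^sub>1 \<turnstile> \<Gamma> @ \<Delta>"
| Weak: "\<rho> \<turnstile> \<Gamma> \<Longrightarrow> wf_fm 0 A \<Longrightarrow> Weak A \<rho> \<turnstile> A # \<Gamma>"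
| Contr: "\<rho> \<turnstile> A # A # \<Gamma> \<Longrightarrow> Contr \<rho> \<turnstile> A # \<Gamma>"
| Perm: "\<rho> \<turnstile> \<Gamma> @ B # A # \<Delta> \<Longrightarrow> Perm (length \<Gamma>) \<rho> \<turnstile> \<Gamma> @ A # B # \<Delta>"

lemma proves_unique: "\<pi> \<turnstile> \<Gamma> \<Longrightarrow> \<pi> \<turnstile> \<Delta> \<Longrightarrow> \<Gamma> = \<Delta>"
proof (induction arbitrary: \<Delta> rule: proves.induct)
  case (Perm \<rho> \<Gamma> B A \<Delta>')
  from Perm.prems show ?case
    by cases (use Perm.IH in fastforce)
qed (erule proves.cases; fastforce)+

primrec cut_formulas :: "('f, 'p) lkproof \<Rightarrow> ('f, 'p) fm set" where
  "cut_formulas (Ax p ts) = {}"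
| "cut_formulas (OrI \<rho>) = cut_formulas \<rho>"
| "cut_formulas (AndI \<rho>\<^sub>0 \<rho>\<^sub>1) = cut_formulas \<rho>\<^sub>0 \<union> cut_formulas \<rho>\<^sub>1"
| "cut_formulas (AllI \<alpha> A \<rho>) = cut_formulas \<rho>"
| "cut_formulas (ExI A r \<rho>) = cut_formulas \<rho>"
| "cut_formulas (Cut A \<rho>\<^sub>0 \<rho>\<^sub>1) = {A, dual A} \<union> cut_formulas \<rho>\<^sub>0 \<union> cut_formulas \<rho>\<^sub>1"
| "cut_formulas (Weak A \<rho>) = cut_formulas \<rho>"
| "cut_formulas (Contr \<rho>) = cut_formulas \<rho>"
| "cut_formulas (Perm k \<rho>) = cut_formulas \<rho>"

primrec eigenvars :: "('f, 'p) lkproof \<Rightarrow> nat set" where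
  "eigenvars (Ax p ts) = {}"
| "eigenvars (OrI \<rho>) = eigenvars \<rho>"
| "eigenvars (AndI \<rho>\<^sub>0 \<rho>\<^sub>1) = eigenvars \<rho>\<^sub>0 \<union> eigenvars \<rho>\<^sub>1"
| "eigenvars (AllI \<alpha> A \<rho>) = insert \<alpha> (eigenvars \<rho>)"
| "eigenvars (ExI A r \<rho>) = eigenvars \<rho>"
| "eigenvars (Cut A \<rho>\<^sub>0 \<rho>\<^sub>1) = eigenvars \<rho>\<^sub>0 \<union> eigenvars \<rho>\<^sub>1"
| "eigenvars (Weak A \<rho>) = eigenvars \<rho>"
| "eigenvars (Contr \<rho>) = eigenvars \<rho>"
| "eigenvars (Perm k \<rho>) = eigenvars \<rho>"

text \<open>The free variables occurring in some sequent or some witness of the proof: going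
  down the proof, new ones enter only through the data recorded in the tree.\<close>

primrec fv_proof :: "('f, 'p) lkproof \<Rightarrow> nat set" where
  "fv_proof (Ax p ts) = (\<Union>t\<in>set ts. fv_tm t)"
| "fv_proof (OrI \<rho>) = fv_proof \<rho>"
| "fv_proof (AndI \<rho>\<^sub>0 \<rho>\<^sub>1) = fv_proof \<rho>\<^sub>0 \<union> fv_proof \<rho>\<^sub>1"
| "fv_proof (AllI \<alpha> A \<rho>) = {\<alpha>} \<union> fv A \<union> fv_proof \<rho>"
| "fv_proof (ExI A r \<rho>) = fv A \<union> fv_tm r \<union> fv_proof \<rho>"
| "fv_proof (Cut A \<rho>\<^sub>0 \<rho>\<^sub>1) = fv A \<union> fv_proof \<rho>\<^sub>0 \<union> fv_proof \<rho>\<^sub>1"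
| "fv_proof (Weak A \<rho>) = fv A \<union> fv_proof \<rho>"
| "fv_proof (Contr \<rho>) = fv_proof \<rho>"
| "fv_proof (Perm k \<rho>) = fv_proof \<rho>"

text \<open>Regularity: an eigenvariable belongs to a single strong quantifier inference and occurs
  in the proof only above that inference. Distinctness of eigenvariables alone would not
  be enough: the explicit substitution \<open>[\<alpha> \<mapsto> z]\<close> produced by one inference could then capture a
  free variable \<open>\<alpha>\<close> of an unrelated branch.\<close>

primrec regular :: "('f, 'p) lkproof \<Rightarrow> bool" where
  "regular (Ax p ts) = True"
| "regular (OrI \<rho>) = regular \<rho>"
| "regular (AndI \<rho>\<^sub>0 \<rho>\<^sub>1) = (regular \<rho>\<^sub>0 \<and> regular \<rho>\<^sub>1 \<and>
    eigenvars \<rho>\<^sub>0 \<inter> fv_proof \<rho>\<^sub>1 = {} \<and> eigenvars \<rho>\<^sub>1 \<inter> fv_proof \<rho>\<^sub>0 = {})"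
| "regular (AllI \<alpha> A \<rho>) = (regular \<rho> \<and> eigenvars \<rho> \<inter> ({\<alpha>} \<union> fv A) = {})"
| "regular (ExI A r \<rho>) = (regular \<rho> \<and> eigenvars \<rho> \<inter> (fv A \<union> fv_tm r) = {})"
| "regular (Cut A \<rho>\<^sub>0 \<rho>\<^sub>1) = (regular \<rho>\<^sub>0 \<and> regular \<rho>\<^sub>1 \<and>
    eigenvars \<rho>\<^sub>0 \<inter> fv_proof \<rho>\<^sub>1 = {} \<and> eigenvars \<rho>\<^sub>1 \<inter> fv_proof \<rho>\<^sub>0 = {})"
| "regular (Weak A \<rho>) = (regular \<rho> \<and> eigenvars \<rho> \<inter> fv A = {})"
| "regular (Contr \<rho>) = regular \<rho>"
| "regular (Perm k \<rho>) = regular \<rho>"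


section \<open>Types\<close>

datatype ty = Ind | Eps | Prod ty ty | Arr ty ty

definition opow :: "nat \<Rightarrow> ty" where
  "opow k = (Prod Ind ^^ k) Eps"

text \<open>Number of existential and universal quantifiers of a prenex formula.\<close>

fun n_ex :: "('f, 'p) fm \<Rightarrow> nat" where
  "n_ex (Exists A) = Suc (n_ex A)"
| "n_ex (Forall A) = n_ex A"
| "n_ex _ = 0"

fun n_all :: "('f, 'p) fm \<Rightarrow> nat" where
  "n_all (Forall A) = Suc (n_all A)"
| "n_all (Exists A) = n_all A"
| "n_all _ = 0"

text \<open>\<open>tau\<close> and \<open>tau_star\<close> are meaningful for prenex \<open>\<Pi>\<^sub>2\<close> and \<open>\<Sigma>\<^sub>2\<close> formulas only. A \<open>\<Sigma>\<^sub>1\<close> formula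
  counts as \<open>\<Pi>\<^sub>2\<close> with an empty universal block, hence has \<open>tau_star\<close> equal to \<open>Eps\<close>.\<close>

definition tau :: "('f, 'p) fm \<Rightarrow> ty" where
  "tau F = opow (n_ex F)"

definition tau_star :: "('f, 'p) fm \<Rightarrow> ty" where
  "tau_star F = (case F of
      Exists _ \<Rightarrow> if n_all F = 0 then Eps else (Arr Ind ^^ n_ex F) (opow (n_all F))
    | _ \<Rightarrow> opow (n_all F))"


section \<open>Terms of the grammar\<close>

text \<open>\<open>Var\<close> are the variables bound by \<open>Lam\<close>, as de Bruijn indices. \<open>ESub s \<alpha> t\<close> is the explicit
  substitution \<open>s[\<alpha> \<mapsto> t]\<close>, with \<open>s\<close> of type \<open>o\<close> or, componentwise, of type \<open>o\<^sup>k\<close>. \<open>NT \<rho> i\<close> is the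
  non-terminal \<open>\<sigma>\<close> with subscript \<open>\<rho>\<close> and superscript \<open>i\<close>.\<close>

datatype ('f, 'p) gtm =
    Var nat
  | Lam "('f, 'p) gtm"
  | App "('f, 'p) gtm" "('f, 'p) gtm"
  | Unit
  | Star "('f, 'p) gtm" "('f, 'p) gtm"
  | Tm "'f tm"
  | ESub "('f, 'p) gtm" nat "('f, 'p) gtm"
  | NT "('f, 'p) lkproof" nat

primrec shift :: "nat \<Rightarrow> nat \<Rightarrow> ('f, 'p) gtm \<Rightarrow> ('f, 'p) gtm" where
  "shift d k (Var i) = (if i < k then Var i else Var (i + d))"
| "shift d k (Lam s) = Lam (shift d (Suc k) s)"
| "shift d k (App s t) = App (shift d k s) (shift d k t)"
| "shift d k Unit = Unit"
| "shift d k (Star s t) = Star (shift d k s) (shift d k t)"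
| "shift d k (Tm r) = Tm r"
| "shift d k (ESub s a t) = ESub (shift d k s) a (shift d k t)"
| "shift d k (NT \<rho> i) = NT \<rho> i"

primrec bsubst :: "nat \<Rightarrow> ('f, 'p) gtm \<Rightarrow> ('f, 'p) gtm \<Rightarrow> ('f, 'p) gtm" where
  "bsubst k u (Var i) = (if i < k then Var i else if i = k then u else Var (i - 1))"
| "bsubst k u (Lam s) = Lam (bsubst (Suc k) (shift 1 0 u) s)"
| "bsubst k u (App s t) = App (bsubst k u s) (bsubst k u t)"
| "bsubst k u Unit = Unit"
| "bsubst k u (Star s t) = Star (bsubst k u s) (bsubst k u t)"
| "bsubst k u (Tm r) = Tm r"
| "bsubst k u (ESub s a t) = ESub (bsubst k u s) a (bsubst k u t)"
| "bsubst k u (NT \<rho> i) = NT \<rho> i"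

definition apps :: "('f, 'p) gtm \<Rightarrow> ('f, 'p) gtm list \<Rightarrow> ('f, 'p) gtm" where
  "apps s ts = foldl App s ts"

definition tuple :: "('f, 'p) gtm list \<Rightarrow> ('f, 'p) gtm" where
  "tuple us = foldr Star us Unit"

text \<open>\<open>z \<cdot> r\<close> for an argument \<open>z\<close> of type \<open>tau_star F\<close>\<close>

definition dot :: "('f, 'p) fm \<Rightarrow> ('f, 'p) gtm \<Rightarrow> 'f tm \<Rightarrow> ('f, 'p) gtm" where
  "dot F z r = (if tau_star F = Eps then z else App z (Tm r))"

text \<open>For \<open>\<theta> \<turnstile> F, \<Gamma>\<close> with \<open>F = \<forall>v\<^sub>0 \<dots> \<forall>v\<^sub>m G\<close> and \<open>G\<close> in \<open>\<Sigma>\<^sub>1\<close>, the term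
  \<open>\<lambda>z\<^sub>0 \<dots> z\<^sub>m. \<sigma> \<langle>z\<^sub>0, \<dots>, z\<^sub>m\<rangle> xs\<close> with body of type \<open>tau F\<close>. It has to be of type \<open>tau_star (dual F)\<close>.
  If \<open>G\<close> is quantifier-free, both types are \<open>\<epsilon>\<close>; then \<open>o \<rightarrow> \<dots> \<rightarrow> o \<rightarrow> \<epsilon>\<close> is identified with \<open>\<epsilon>\<close>
  and the term with \<open>\<langle>\<rangle>\<close>.\<close>

definition abstr :: "('f, 'p) fm \<Rightarrow> ('f, 'p) lkproof \<Rightarrow> ('f, 'p) gtm list \<Rightarrow> ('f, 'p) gtm" where
  "abstr F \<theta> xs =
    (if tau F = Eps then Unit
     else let m = n_all F in
       (Lam ^^ m) (apps (NT \<theta> 0) (tuple (map Var (rev [0..<m])) # map (shift m 0) xs)))"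

text \<open>\<open>compose F \<theta>\<^sub>0 \<theta>\<^sub>1 xs ys\<close> is the composition at \<open>F\<close> of the non-terminals with superscript \<open>0\<close> of
  \<open>\<theta>\<^sub>0 \<turnstile> F, \<Gamma>\<close> and \<open>\<theta>\<^sub>1 \<turnstile> dual F, \<Delta>\<close>, applied to \<open>xs\<close> and \<open>ys\<close>.\<close>

definition compose :: "('f, 'p) fm \<Rightarrow> ('f, 'p) lkproof \<Rightarrow> ('f, 'p) lkproof \<Rightarrow>
    ('f, 'p) gtm list \<Rightarrow> ('f, 'p) gtm list \<Rightarrow> ('f, 'p) gtm" where
  "compose F \<theta>\<^sub>0 \<theta>\<^sub>1 xs ys = (case F of
      Forall _ \<Rightarrow> abstr F \<theta>\<^sub>0 xs
    | Exists _ \<Rightarrow> apps (NT \<theta>\<^sub>0 0) (abstr (dual F) \<theta>\<^sub>1 ys # xs)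
    | _ \<Rightarrow> Unit)"


section \<open>Production rules and language\<close>

text \<open>The rules for \<open>\<or>\<close> and \<open>\<and>\<close> are forced by the types, as the principal formula and its immediate
  subformulas are quantifier-free: their arguments and results have type \<open>\<epsilon>\<close>.\<close>

inductive production :: "'f \<Rightarrow> ('f, 'p) gtm \<Rightarrow> ('f, 'p) gtm \<Rightarrow> bool" for c :: 'f where
  Ax_0: "production c (apps (NT (Ax p ts) 0) [z\<^sub>0, z\<^sub>1]) z\<^sub>1"
| Ax_1: "production c (apps (NT (Ax p ts) 1) [z\<^sub>0, z\<^sub>1]) z\<^sub>0"
| Or_0: "\<rho> \<turnstile> A # B # \<Gamma> \<Longrightarrow> length ys = length \<Gamma> \<Longrightarrow>
    production c (apps (NT (OrI \<rho>) 0) (z # ys)) Unit"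
| Or_Suc: "\<rho> \<turnstile> A # B # \<Gamma> \<Longrightarrow> length ys = length \<Gamma> \<Longrightarrow> 0 < i \<Longrightarrow> i \<le> length \<Gamma> \<Longrightarrow>
    production c (apps (NT (OrI \<rho>) i) (z # ys)) (apps (NT \<rho> (i + 1)) (Unit # Unit # ys))"
| And_0: "\<rho>\<^sub>0 \<turnstile> A # \<Gamma> \<Longrightarrow> \<rho>\<^sub>1 \<turnstile> B # \<Delta> \<Longrightarrow> length xs = length \<Gamma> \<Longrightarrow> length ys = length \<Delta> \<Longrightarrow>
    production c (apps (NT (AndI \<rho>\<^sub>0 \<rho>\<^sub>1) 0) (z # xs @ ys)) Unit"
| And_left: "\<rho>\<^sub>0 \<turnstile> A # \<Gamma> \<Longrightarrow> \<rho>\<^sub>1 \<turnstile> B # \<Delta> \<Longrightarrow> length xs = length \<Gamma> \<Longrightarrow> length ys = length \<Delta> \<Longrightarrow>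
    0 < i \<Longrightarrow> i \<le> length \<Gamma> \<Longrightarrow>
    production c (apps (NT (AndI \<rho>\<^sub>0 \<rho>\<^sub>1) i) (z # xs @ ys)) (apps (NT \<rho>\<^sub>0 i) (Unit # xs))"
| And_right: "\<rho>\<^sub>0 \<turnstile> A # \<Gamma> \<Longrightarrow> \<rho>\<^sub>1 \<turnstile> B # \<Delta> \<Longrightarrow> length xs = length \<Gamma> \<Longrightarrow> length ys = length \<Delta> \<Longrightarrow>
    length \<Gamma> < i \<Longrightarrow> i \<le> length \<Gamma> + length \<Delta> \<Longrightarrow>
    production c (apps (NT (AndI \<rho>\<^sub>0 \<rho>\<^sub>1) i) (z # xs @ ys))
      (apps (NT \<rho>\<^sub>1 (i - length \<Gamma>)) (Unit # ys))"
| Forall: "AllI \<alpha> A \<rho> \<turnstile> Forall A # \<Gamma> \<Longrightarrow> length ys = length \<Gamma> \<Longrightarrow> i \<le> length \<Gamma> \<Longrightarrow>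
    production c (apps (NT (AllI \<alpha> A \<rho>) i) (Star z\<^sub>0 z\<^sub>1 # ys))
      (ESub (apps (NT \<rho> i) (z\<^sub>1 # ys)) \<alpha> z\<^sub>0)"
| Ex_0: "ExI A r \<rho> \<turnstile> Exists A # \<Gamma> \<Longrightarrow> length ys = length \<Gamma> \<Longrightarrow>
    production c (apps (NT (ExI A r \<rho>) 0) (z # ys))
      (Star (Tm r) (apps (NT \<rho> 0) (dot (Exists A) z r # ys)))"
| Ex_Suc: "ExI A r \<rho> \<turnstile> Exists A # \<Gamma> \<Longrightarrow> length ys = length \<Gamma> \<Longrightarrow> 0 < i \<Longrightarrow> i \<le> length \<Gamma> \<Longrightarrow>
    production c (apps (NT (ExI A r \<rho>) i) (z # ys)) (apps (NT \<rho> i) (dot (Exists A) z r # ys))"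
| Cut_left: "\<rho>\<^sub>0 \<turnstile> A # \<Gamma> \<Longrightarrow> \<rho>\<^sub>1 \<turnstile> dual A # \<Delta> \<Longrightarrow> length xs = length \<Gamma> \<Longrightarrow> length ys = length \<Delta> \<Longrightarrow>
    i < length \<Gamma> \<Longrightarrow>
    production c (apps (NT (Cut A \<rho>\<^sub>0 \<rho>\<^sub>1) i) (xs @ ys))
      (apps (NT \<rho>\<^sub>0 (i + 1)) (compose (dual A) \<rho>\<^sub>1 \<rho>\<^sub>0 ys xs # xs))"
| Cut_right: "\<rho>\<^sub>0 \<turnstile> A # \<Gamma> \<Longrightarrow> \<rho>\<^sub>1 \<turnstile> dual A # \<Delta> \<Longrightarrow> length xs = length \<Gamma> \<Longrightarrow> length ys = length \<Delta> \<Longrightarrow>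
    length \<Gamma> \<le> i \<Longrightarrow> i < length \<Gamma> + length \<Delta> \<Longrightarrow>
    production c (apps (NT (Cut A \<rho>\<^sub>0 \<rho>\<^sub>1) i) (xs @ ys))
      (apps (NT \<rho>\<^sub>1 (i - length \<Gamma> + 1)) (compose A \<rho>\<^sub>0 \<rho>\<^sub>1 xs ys # ys))"
| Contr_0: "\<rho> \<turnstile> A # A # \<Gamma> \<Longrightarrow> length ys = length \<Gamma> \<Longrightarrow> j \<in> {0, 1} \<Longrightarrow>
    production c (apps (NT (Contr \<rho>) 0) (z # ys)) (apps (NT \<rho> j) (z # z # ys))"
| Contr_Suc: "\<rho> \<turnstile> A # A # \<Gamma> \<Longrightarrow> length ys = length \<Gamma> \<Longrightarrow> 0 < i \<Longrightarrow> i \<le> length \<Gamma> \<Longrightarrow>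
    production c (apps (NT (Contr \<rho>) i) (z # ys)) (apps (NT \<rho> (i + 1)) (z # z # ys))"
| Weak_0: "\<rho> \<turnstile> \<Gamma> \<Longrightarrow> length ys = length \<Gamma> \<Longrightarrow>
    production c (apps (NT (Weak A \<rho>) 0) (z # ys)) (tuple (replicate (n_ex A) (Tm (Fn c []))))"
| Weak_Suc: "\<rho> \<turnstile> \<Gamma> \<Longrightarrow> length ys = length \<Gamma> \<Longrightarrow> 0 < i \<Longrightarrow> i \<le> length \<Gamma> \<Longrightarrow>
    production c (apps (NT (Weak A \<rho>) i) (z # ys)) (apps (NT \<rho> (i - 1)) ys)"
| Perm: "\<rho> \<turnstile> \<Gamma> @ B # A # \<Delta> \<Longrightarrow> k = length \<Gamma> \<Longrightarrow> length xs = k \<Longrightarrow> length ys = length \<Delta> \<Longrightarrow>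
    i < k + 2 + length \<Delta> \<Longrightarrow> j = (if i = k then k + 1 else if i = k + 1 then k else i) \<Longrightarrow>
    production c (apps (NT (Perm k \<rho>) i) (xs @ z\<^sub>0 # z\<^sub>1 # ys))
      (apps (NT \<rho> j) (xs @ z\<^sub>1 # z\<^sub>0 # ys))"

text \<open>One derivation step, anywhere in a term. The rules \<open>ESub_Star\<close> and \<open>ESub_Unit\<close> say that an
  explicit substitution acts componentwise on sequences.\<close>

inductive step :: "'f \<Rightarrow> ('f, 'p) gtm \<Rightarrow> ('f, 'p) gtm \<Rightarrow> bool" for c :: 'f where
  Prod: "production c s t \<Longrightarrow> step c s t"
| Beta: "step c (App (Lam s) t) (bsubst 0 t s)"
| ESub_Star: "step c (ESub (Star u v) a t) (Star (ESub u a t) (ESub v a t))"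
| ESub_Unit: "step c (ESub Unit a t) Unit"
| Lam: "step c s s' \<Longrightarrow> step c (Lam s) (Lam s')"
| App_1: "step c s s' \<Longrightarrow> step c (App s t) (App s' t)"
| App_2: "step c t t' \<Longrightarrow> step c (App s t) (App s t')"
| Star_1: "step c s s' \<Longrightarrow> step c (Star s t) (Star s' t)"
| Star_2: "step c t t' \<Longrightarrow> step c (Star s t) (Star s t')"
| ESub_1: "step c s s' \<Longrightarrow> step c (ESub s a t) (ESub s' a t)"
| ESub_2: "step c t t' \<Longrightarrow> step c (ESub s a t) (ESub s a t')"

text \<open>Structured first-order terms, and non-terminal-free sequence-terms of type \<open>o\<^sup>k\<close>\<close>

inductive structured :: "('f, 'p) gtm \<Rightarrow> bool" where
  "structured (Tm r)"
| "structured s \<Longrightarrow> structured t \<Longrightarrow> structured (ESub s a t)"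

inductive seqterm :: "nat \<Rightarrow> ('f, 'p) gtm \<Rightarrow> bool" where
  "seqterm 0 Unit"
| "structured u \<Longrightarrow> seqterm k v \<Longrightarrow> seqterm (Suc k) (Star u v)"
| "seqterm k v \<Longrightarrow> structured t \<Longrightarrow> seqterm k (ESub v a t)"

text \<open>Evaluation of all explicit substitutions in a structured term and in a sequence-term\<close>

fun eval_tm :: "('f, 'p) gtm \<Rightarrow> 'f tm" where
  "eval_tm (Tm r) = r"
| "eval_tm (ESub s a t) = subst_tm a (eval_tm t) (eval_tm s)"
| "eval_tm _ = undefined"

fun eval_seq :: "('f, 'p) gtm \<Rightarrow> 'f tm list" where
  "eval_seq Unit = []"
| "eval_seq (Star u v) = eval_tm u # eval_seq v"
| "eval_seq (ESub v a t) = map (subst_tm a (eval_tm t)) (eval_seq v)"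
| "eval_seq _ = undefined"

definition lang :: "'f \<Rightarrow> ('f, 'p) lkproof \<Rightarrow> (nat \<times> 'f tm list) set" where
  "lang c \<pi> = {(i, eval_seq T) | i T. \<exists>\<Gamma>. \<pi> \<turnstile> \<Gamma> \<and> i < length \<Gamma> \<and>
      (step c)\<^sup>*\<^sup>* (apps (NT \<pi> i) (replicate (length \<Gamma>) Unit)) T \<and>
      seqterm (n_ex (\<Gamma> ! i)) T}"


section \<open>Expansions and tautologies\<close>

fun instance_of :: "('f, 'p) fm \<Rightarrow> 'f tm list \<Rightarrow> ('f, 'p) fm" where
  "instance_of (Exists A) (t # ts) = instance_of (inst 0 t A) ts"
| "instance_of A _ = A"

text \<open>A disjunction is represented by the set of its disjuncts; an expansion is a sequent of
  disjunctions.\<close>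

definition expansion :: "('f, 'p) fm list \<Rightarrow> (nat \<times> 'f tm list) set \<Rightarrow> ('f, 'p) fm set list" where
  "expansion \<Gamma> L = map (\<lambda>i. {instance_of (\<Gamma> ! i) ts | ts. (i, ts) \<in> L}) [0..<length \<Gamma>]"

text \<open>Truth of a quantifier-free formula under an assignment of truth values to atoms; the value
  for quantified formulas is irrelevant.\<close>

primrec holds :: "('p \<Rightarrow> 'f tm list \<Rightarrow> bool) \<Rightarrow> ('f, 'p) fm \<Rightarrow> bool" where
  "holds v (Lit b p ts) = (v p ts = b)"
| "holds v (And A B) = (holds v A \<and> holds v B)"
| "holds v (Or A B) = (holds v A \<or> holds v B)"
| "holds v (Forall A) = False"
| "holds v (Exists A) = False"

definition tautology :: "('f, 'p) fm set list \<Rightarrow> bool" where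
  "tautology Ds \<longleftrightarrow> (\<forall>v. \<exists>D\<in>set Ds. \<exists>A\<in>D. holds v A)"

end

theory Submission
  imports Defs
begin

text \<open>Fix a truth assignment. A counter-witness for \<open>\<forall>\<^sup>m\<exists>\<^sup>n G\<close> is an \<open>m\<close>-tuple of terms; for a proper
  \<open>\<Sigma>\<^sub>2\<close> formula \<open>\<exists>\<^sup>m\<forall>\<^sup>n G\<close> it is a total non-deterministic function from \<open>m\<close>-tuples to \<open>n\<close>-tuples. For
  every proof of \<open>\<Gamma>\<close> and every choice of counter-witnesses for the formulas of \<open>\<Gamma>\<close>, some non-terminal of
  the proof derives a tuple that defeats the counter-witness of its formula. This goes by
  induction on the proof. At a cut on \<open>F = \<forall>\<^sup>m\<exists>\<^sup>n G\<close>, the premise proving \<open>F\<close> itself provides the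
  counter-witness for \<open>dual F\<close>: if the other premise derives a tuple \<open>s\<close> defeating it, then \<open>s\<close>
  serves as counter-witness for \<open>F\<close>, and the first premise cannot answer \<open>s\<close> with a true instance
  of \<open>G\<close>, so it defeats the counter-witness of a side formula. Counter-witnesses are related to
  terms of the grammar by a Kripke logical relation, whose worlds record the values
  and the names of the variables that are in scope; regularity is used only there, to prevent
  explicit substitutions from capturing variables of the arguments.\<close>

section \<open>Environments and substitution\<close>

text \<open>Counter-witnesses and denotations never mention the truth assignment; it enters only
  when a result is compared with its formula in \<open>wins\<close>. Values are sets because
  contraction has two productions: which copy answers correctly depends on the assignment, so a
  function built from a non-terminal must offer all its results, and winning means beating all
  answers of the counter-witness. The price is that an empty set of answers is beaten vacuously
  although nothing can be derived from it. Hence \<open>sound\<close> carries two claims,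
  \<open>winning\<close> and \<open>total\<close>, and the second one keeps the functions passed at
  cuts non-empty. The other obstacle is call by name: productions copy their arguments unevaluated,
  possibly below an explicit substitution, so that one argument may be evaluated in several scopes.
  A semantic value must not depend on this, hence \<open>denote\<close> keeps only results obtained
  from all realizers in all admissible worlds.\<close>

primrec env_tm :: "(nat \<Rightarrow> 'f tm) \<Rightarrow> 'f tm \<Rightarrow> 'f tm" where
  "env_tm \<theta> (Free a) = \<theta> a"
| "env_tm \<theta> (Bound i) = Bound i"
| "env_tm \<theta> (Fn f ts) = Fn f (map (env_tm \<theta>) ts)"

primrec env_fm :: "(nat \<Rightarrow> 'f tm) \<Rightarrow> ('f, 'p) fm \<Rightarrow> ('f, 'p) fm" where
  "env_fm \<theta> (Lit b p ts) = Lit b p (map (env_tm \<theta>) ts)"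
| "env_fm \<theta> (And A B) = And (env_fm \<theta> A) (env_fm \<theta> B)"
| "env_fm \<theta> (Or A B) = Or (env_fm \<theta> A) (env_fm \<theta> B)"
| "env_fm \<theta> (Forall A) = Forall (env_fm \<theta> A)"
| "env_fm \<theta> (Exists A) = Exists (env_fm \<theta> A)"

text \<open>Values without dangling indices are left alone by \<open>inst_tm\<close>; this makes
  environments commute with instantiation in \<open>env_fm_inst\<close>.\<close>

definition env_wf :: "(nat \<Rightarrow> 'f tm) \<Rightarrow> bool" where
  "env_wf \<theta> \<longleftrightarrow> (\<forall>a. wf_tm 0 (\<theta> a))"

lemma env_wf_Free: "env_wf Free"
  by (simp add: env_wf_def)

lemma env_wf_upd: "env_wf \<theta> \<Longrightarrow> wf_tm 0 t \<Longrightarrow> env_wf (\<theta>(a := t))"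
  by (simp add: env_wf_def)

lemma env_tm_Free [simp]: "env_tm Free t = t"
  by (induction t) (auto simp: map_idI)

lemma env_fm_Free [simp]: "env_fm Free A = A"
  by (induction A) (auto simp: map_idI)

lemma env_tm_cong: "(\<And>a. a \<in> fv_tm t \<Longrightarrow> \<theta> a = \<theta>' a) \<Longrightarrow> env_tm \<theta> t = env_tm \<theta>' t"
  by (induction t) auto

lemma env_fm_cong: "(\<And>a. a \<in> fv A \<Longrightarrow> \<theta> a = \<theta>' a) \<Longrightarrow> env_fm \<theta> A = env_fm \<theta>' A"
  by (induction A) (auto intro!: env_tm_cong)

text \<open>Turns an evaluated explicit substitution into an update of the environment, so that
  \<open>yields_ESub\<close> can pass below \<open>ESub\<close> by changing the world instead of the
  term.\<close>

lemma env_tm_subst_tm: "env_tm \<theta> (subst_tm a r t) = env_tm (\<theta>(a := env_tm \<theta> r)) t"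
  by (induction t) auto

lemma fv_subst_tm: "fv_tm (subst_tm a r t) \<subseteq> (fv_tm t - {a}) \<union> fv_tm r"
  by (induction t) auto

lemma wf_env_tm: "env_wf \<theta> \<Longrightarrow> wf_tm 0 t \<Longrightarrow> wf_tm 0 (env_tm \<theta> t)"
  by (induction t) (auto simp: env_wf_def)

lemma inst_tm_wf: "wf_tm k t \<Longrightarrow> k \<le> j \<Longrightarrow> inst_tm j r t = t"
  by (induction t) (auto simp: map_idI)

lemma env_tm_inst_tm: "env_wf \<theta> \<Longrightarrow> env_tm \<theta> (inst_tm k r t) = inst_tm k (env_tm \<theta> r) (env_tm \<theta> t)"
  by (induction t) (auto simp: env_wf_def inst_tm_wf[where k = 0])

lemma env_fm_inst: "env_wf \<theta> \<Longrightarrow> env_fm \<theta> (inst k r A) = inst k (env_tm \<theta> r) (env_fm \<theta> A)"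
  by (induction A arbitrary: k) (auto simp: env_tm_inst_tm)


section \<open>Prenex formulas\<close>

definition prenex2 :: "('f, 'p) fm \<Rightarrow> bool" where
  "prenex2 F \<longleftrightarrow> pi2 F \<or> sigma2 F"

lemma n_ex_inst [simp]: "n_ex (inst k r A) = n_ex A"
  by (induction A arbitrary: k) auto

lemma n_all_inst [simp]: "n_all (inst k r A) = n_all A"
  by (induction A arbitrary: k) auto

lemma qfree_inst [simp]: "qfree (inst k r A) = qfree A"
  by (induction A arbitrary: k) auto

lemma n_ex_env_fm [simp]: "n_ex (env_fm \<theta> A) = n_ex A"
  by (induction A) auto

lemma n_all_env_fm [simp]: "n_all (env_fm \<theta> A) = n_all A"
  by (induction A) auto

lemma qfree_env_fm [simp]: "qfree (env_fm \<theta> A) = qfree A"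
  by (induction A) auto

lemma n_ex_dual [simp]: "n_ex (dual A) = n_all A"
  by (induction A) auto

lemma n_all_dual [simp]: "n_all (dual A) = n_ex A"
  by (induction A) auto

lemma qfree_dual [simp]: "qfree (dual A) = qfree A"
  by (induction A) auto

lemma dual_dual [simp]: "dual (dual A) = A"
  by (induction A) auto

lemma env_fm_dual: "env_fm \<theta> (dual A) = dual (env_fm \<theta> A)"
  by (induction A) auto

lemma dual_inst: "dual (inst k r A) = inst k r (dual A)"
  by (induction A arbitrary: k) auto

lemma qfree_counts: "qfree A \<Longrightarrow> n_ex A = 0 \<and> n_all A = 0"
  by (cases A) auto

lemma inst_Forall_pow: "inst k r ((Forall ^^ m) A) = (Forall ^^ m) (inst (k + m) r A)"
  by (induction m arbitrary: k) auto

lemma inst_Exists_pow: "inst k r ((Exists ^^ m) A) = (Exists ^^ m) (inst (k + m) r A)"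
  by (induction m arbitrary: k) auto

lemma n_pow [simp]:
  "n_ex ((Exists ^^ m) A) = m + n_ex A" "n_ex ((Forall ^^ m) A) = n_ex A"
  "n_all ((Exists ^^ m) A) = n_all A" "n_all ((Forall ^^ m) A) = m + n_all A"
  by (induction m) auto

lemma dual_pow:
  "dual ((Exists ^^ m) A) = (Forall ^^ m) (dual A)"
  "dual ((Forall ^^ m) A) = (Exists ^^ m) (dual A)"
  by (induction m) auto

lemma prenex2_dual: "prenex2 F \<Longrightarrow> prenex2 (dual F)"
  unfolding prenex2_def pi2_def sigma2_def by (metis dual_pow qfree_dual)

lemma sigma1_prenex2: "sigma1 F \<Longrightarrow> prenex2 F"
  unfolding sigma1_def prenex2_def pi2_def by (metis funpow_0)

lemma pi2_inst: "pi2 F \<Longrightarrow> pi2 (inst k r F)"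
  unfolding pi2_def by (metis inst_Exists_pow inst_Forall_pow qfree_inst)

lemma sigma2_inst: "sigma2 F \<Longrightarrow> sigma2 (inst k r F)"
  unfolding sigma2_def by (metis inst_Exists_pow inst_Forall_pow qfree_inst)

lemma env_fm_pow:
  "env_fm \<theta> ((Exists ^^ m) A) = (Exists ^^ m) (env_fm \<theta> A)"
  "env_fm \<theta> ((Forall ^^ m) A) = (Forall ^^ m) (env_fm \<theta> A)"
  by (induction m) auto

lemma prenex2_env_fm: "prenex2 F \<Longrightarrow> prenex2 (env_fm \<theta> F)"
  unfolding prenex2_def pi2_def sigma2_def by (metis env_fm_pow qfree_env_fm)

lemma prenex2_inst: "prenex2 F \<Longrightarrow> prenex2 (inst k r F)"
  unfolding prenex2_def using pi2_inst sigma2_inst by blast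

lemma prenex2_And: "prenex2 (And A B) \<Longrightarrow> qfree A \<and> qfree B"
  unfolding prenex2_def pi2_def sigma2_def
proof (elim disjE exE conjE)
  fix m n and G :: "('a, 'b) fm"
  assume "qfree G" "And A B = (Forall ^^ m) ((Exists ^^ n) G)"
  then show ?thesis by (cases m; cases n) auto
next
  fix m n and G :: "('a, 'b) fm"
  assume "qfree G" "And A B = (Exists ^^ m) ((Forall ^^ n) G)"
  then show ?thesis by (cases m; cases n) auto
qed

lemma prenex2_Or: "prenex2 (Or A B) \<Longrightarrow> qfree A \<and> qfree B"
  using prenex2_And[of "dual A" "dual B"] prenex2_dual[of "Or A B"] by simp

lemma qfree_prenex2: "qfree A \<Longrightarrow> prenex2 A"
  unfolding prenex2_def pi2_def by (metis funpow_0)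

text \<open>The formulas whose counter-witnesses are functions, i.e. proper \<open>\<Sigma>\<^sub>2\<close> formulas.\<close>

definition is_sigma2 :: "('f, 'p) fm \<Rightarrow> bool" where
  "is_sigma2 F \<longleftrightarrow> (\<exists>A. F = Exists A) \<and> n_all F > 0"

text \<open>Follows \<open>tau_star\<close>: a Sigma_1 formula counts as Pi_2 with an empty
  universal block, so its counter-witness takes no argument even if \<open>n_ex\<close> is
  positive.\<close>

definition arity :: "('f, 'p) fm \<Rightarrow> nat" where
  "arity F = (if is_sigma2 F then n_ex F else 0)"

lemma is_sigma2_simps [simp]:
  "is_sigma2 (Exists A) \<longleftrightarrow> n_all A > 0" "\<not> is_sigma2 (Forall A)" "\<not> is_sigma2 (And A B)"
  "\<not> is_sigma2 (Or A B)" "\<not> is_sigma2 (Lit b p ts)"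
  by (auto simp: is_sigma2_def)

lemma is_sigma2_qfree: "qfree A \<Longrightarrow> \<not> is_sigma2 A"
  by (cases A) auto

lemma is_sigma2_inst [simp]: "is_sigma2 (inst k r A) = is_sigma2 A"
  by (cases A) (auto simp: is_sigma2_def)

lemma is_sigma2_env_fm [simp]: "is_sigma2 (env_fm \<theta> A) = is_sigma2 A"
  by (cases A) (auto simp: is_sigma2_def)

lemma arity_inst [simp]: "arity (inst k r A) = arity A"
  by (simp add: arity_def)

lemma prenex2_Forall: assumes "prenex2 (Forall A)" shows "prenex2 A" "\<not> is_sigma2 A"
proof -
  have "\<exists>m n G. qfree G \<and> A = (Forall ^^ m) ((Exists ^^ n) G)"
    using assms unfolding prenex2_def pi2_def sigma2_def
  proof (elim disjE exE conjE)
    fix m n and G :: "('a, 'b) fm"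
    assume G: "qfree G" "Forall A = (Forall ^^ m) ((Exists ^^ n) G)"
    then have "A = (Forall ^^ (m - 1)) ((Exists ^^ n) G)" by (cases m; cases n) auto
    with G show ?thesis by blast
  next
    fix m n and G :: "('a, 'b) fm"
    assume G: "qfree G" "Forall A = (Exists ^^ m) ((Forall ^^ n) G)"
    \<comment> \<open>The leading universal quantifier forces \<open>m = 0\<close>; the formula is
      purely universal, hence Pi_2 with an empty existential block.\<close>
    then have "A = (Forall ^^ (n - 1)) ((Exists ^^ 0) G)" by (cases m; cases n) auto
    with G show ?thesis by blast
  qed
  then obtain m n G where G: "qfree G" "A = (Forall ^^ m) ((Exists ^^ n) G)" by blast
  then show "prenex2 A" unfolding prenex2_def pi2_def by blast
  show "\<not> is_sigma2 A" using G qfree_counts[of G] is_sigma2_qfree[of G]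
    by (cases m; cases n) auto
qed

lemma prenex2_Exists: "prenex2 (Exists A) \<Longrightarrow> prenex2 A"
  using prenex2_Forall(1)[of "dual A"] prenex2_dual[of "Exists A"] prenex2_dual[of "dual A"] by simp

text \<open>If stripping an existential quantifier from a proper Sigma_2 formula leaves one that is
  no longer of this kind, that quantifier was the last of its block. This is the point where a
  function turns into a sequence, see \<open>next_val.select\<close>.\<close>

lemma prenex2_Exists_not_fun:
  assumes "prenex2 (Exists A)" "n_all A > 0" "\<not> is_sigma2 A"
  shows "n_ex A = 0"
  using assms(1) unfolding prenex2_def pi2_def sigma2_def
proof (elim disjE exE conjE)
  fix m n and G :: "('a, 'b) fm"
  assume G: "qfree G" "Exists A = (Forall ^^ m) ((Exists ^^ n) G)"
  with assms(2) show ?thesis using qfree_counts[of G] by (cases m; cases n) auto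
next
  fix m n and G :: "('a, 'b) fm"
  assume G: "qfree G" "Exists A = (Exists ^^ m) ((Forall ^^ n) G)"
  show ?thesis
  proof (cases m)
    case 0
    with G show ?thesis by (cases n) auto
  next
    case (Suc m')
    with G have "A = (Exists ^^ m') ((Forall ^^ n) G)" by simp
    with G assms(2,3) show ?thesis using qfree_counts[of G] by (cases m') auto
  qed
qed

lemma prenex2_no_quantifiers: "prenex2 A \<Longrightarrow> n_all A = 0 \<Longrightarrow> n_ex A = 0 \<Longrightarrow> qfree A"
  by (cases A) (auto dest: prenex2_And prenex2_Or)

text \<open>Unlike \<open>instance_of\<close> it strips universal quantifiers as well: witness and
  counter-witness, concatenated in quantifier order, form one complete instance. A formula and its
  dual consume the same list, which lets a cut compare them.\<close>

fun full_inst :: "('f, 'p) fm \<Rightarrow> 'f tm list \<Rightarrow> ('f, 'p) fm" where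
  "full_inst (Exists A) (t # ts) = full_inst (inst 0 t A) ts"
| "full_inst (Forall A) (t # ts) = full_inst (inst 0 t A) ts"
| "full_inst A _ = A"

lemma full_inst_Nil [simp]: "full_inst A [] = A"
  by (cases A) auto

lemma full_inst_dual: "full_inst (dual A) ts = dual (full_inst A ts)"
  by (induction A ts rule: full_inst.induct) (auto simp: dual_inst[symmetric])

lemma prenex2_full_inst:
  "prenex2 A \<Longrightarrow> length ts = n_all A + n_ex A \<Longrightarrow> qfree (full_inst A ts)"
proof (induction A ts rule: full_inst.induct)
  case (1 A t ts)
  then show ?case using prenex2_Exists prenex2_inst by fastforce
next
  case (2 A t ts)
  then show ?case using prenex2_Forall prenex2_inst by fastforce
qed (auto simp: prenex2_no_quantifiers dest: prenex2_And prenex2_Or)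

lemma holds_dual: "qfree A \<Longrightarrow> holds v (dual A) \<longleftrightarrow> \<not> holds v A"
  by (induction A) auto

lemma full_inst_instance_of: "n_all A = 0 \<Longrightarrow> full_inst A ts = instance_of A ts"
  by (induction A ts rule: full_inst.induct) auto

section \<open>Derivations\<close>

abbreviation steps :: "'f \<Rightarrow> ('f, 'p) gtm \<Rightarrow> ('f, 'p) gtm \<Rightarrow> bool" where
  "steps c \<equiv> (step c)\<^sup>*\<^sup>*"

lemma apps_simps [simp]: "apps s [] = s" "apps s (t # ts) = apps (App s t) ts"
  by (simp_all add: apps_def)

lemma tuple_simps [simp]: "tuple [] = Unit" "tuple (t # ts) = Star t (tuple ts)"
  by (simp_all add: tuple_def)

lemma steps_map:
  assumes "\<And>s s'. step c s s' \<Longrightarrow> step c (f s) (f s')" and "steps c s s'"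
  shows "steps c (f s) (f s')"
  using assms(2) by (induction) (auto intro: assms(1) rtranclp.rtrancl_into_rtrancl)

lemma step_apps_head: "step c s s' \<Longrightarrow> step c (apps s ts) (apps s' ts)"
  by (induction ts arbitrary: s s') (auto intro: step.App_1)

lemma steps_first_arg: "steps c z z' \<Longrightarrow> steps c (apps s (z # ts)) (apps s (z' # ts))"
  by (rule steps_map[where f = "\<lambda>z. apps s (z # ts)"]) (auto intro: step_apps_head step.App_2)

section \<open>De Bruijn substitution and iterated beta reduction\<close>

lemma shift_structured: "structured t \<Longrightarrow> shift d k t = t"
  by (induction rule: structured.induct) auto

lemma bsubst_structured: "structured t \<Longrightarrow> bsubst k u t = t"
  by (induction rule: structured.induct) auto

lemma shift_zero: "shift 0 k s = s"
  by (induction s arbitrary: k) auto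

text \<open>The shift leaves no free index from \<open>k\<close> to \<open>k + m\<close>, so
  \<open>u\<close> is never inserted and the substitution only lowers the larger indices by
  one.\<close>

lemma bsubst_shift: "k \<le> j \<Longrightarrow> j \<le> k + m \<Longrightarrow> bsubst j u (shift (Suc m) k s) = shift m k s"
  by (induction s arbitrary: k j u) auto

lemma bsubst_apps: "bsubst k u (apps s ts) = apps (bsubst k u s) (map (bsubst k u) ts)"
  by (induction ts arbitrary: s) auto

lemma bsubst_tuple: "bsubst k u (tuple ts) = tuple (map (bsubst k u) ts)"
  by (induction ts) auto

lemma bsubst_Lams:
  "structured u \<Longrightarrow> bsubst k u ((Lam ^^ m) s) = (Lam ^^ m) (bsubst (k + m) u s)"
  by (induction m arbitrary: k) (auto simp: shift_structured)

text \<open>Generalised for the induction: \<open>us\<close> are the arguments already consumed, and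
  each beta step moves one over from \<open>ts\<close>. The outermost \<open>Lam\<close> binds the
  highest index, hence the reversed list of variables. Structured arguments contain no
  \<open>Var\<close>, so they survive unchanged below the remaining binders.\<close>

lemma steps_Lams_tuple:
  assumes "\<forall>t\<in>set ts. structured t" and "\<forall>u\<in>set us. structured u"
  shows "steps c
    (apps ((Lam ^^ length ts)
      (apps (NT \<rho> 0) (tuple (us @ map Var (rev [0..<length ts])) # map (shift (length ts) 0) xs))) ts)
    (apps (NT \<rho> 0) (tuple (us @ ts) # xs))"
  using assms
proof (induction ts arbitrary: us)
  case Nil
  then show ?case by (simp add: shift_zero)
next
  case (Cons t ts)
  let ?m = "length ts"
  have "step c (App ((Lam ^^ Suc ?m)
      (apps (NT \<rho> 0) (tuple (us @ map Var (rev [0..<Suc ?m])) # map (shift (Suc ?m) 0) xs))) t)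
    ((Lam ^^ ?m) (bsubst ?m t
      (apps (NT \<rho> 0) (tuple (us @ map Var (rev [0..<Suc ?m])) # map (shift (Suc ?m) 0) xs))))"
    using step.Beta Cons.prems(1) by (simp add: bsubst_Lams[where k = 0, simplified, symmetric])
  also have "bsubst ?m t
      (apps (NT \<rho> 0) (tuple (us @ map Var (rev [0..<Suc ?m])) # map (shift (Suc ?m) 0) xs)) =
    apps (NT \<rho> 0) (tuple ((us @ [t]) @ map Var (rev [0..<?m])) # map (shift ?m 0) xs)"
  proof -
    have "map (bsubst ?m t \<circ> Var) (rev [0..<?m]) = map Var (rev [0..<?m])"
      by (rule map_cong) auto
    moreover have "map (bsubst ?m t \<circ> shift (Suc ?m) 0) xs = map (shift ?m 0) xs"
      by (simp add: bsubst_shift)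
    moreover have "map (bsubst ?m t) us = us"
      using Cons.prems(2) by (simp add: bsubst_structured map_idI)
    ultimately show ?thesis
      by (simp add: bsubst_apps bsubst_tuple del: apps_simps map_eq_conv)
  qed
  finally have "step c (apps ((Lam ^^ Suc ?m)
      (apps (NT \<rho> 0) (tuple (us @ map Var (rev [0..<Suc ?m])) # map (shift (Suc ?m) 0) xs))) (t # ts))
    (apps ((Lam ^^ ?m)
      (apps (NT \<rho> 0) (tuple ((us @ [t]) @ map Var (rev [0..<?m])) # map (shift ?m 0) xs))) ts)"
    by (simp add: step_apps_head)
  moreover have "steps c \<dots> (apps (NT \<rho> 0) (tuple ((us @ [t]) @ ts) # xs))"
    using Cons.prems by (intro Cons.IH) auto
  ultimately show ?case
    by (simp add: converse_rtranclp_into_rtranclp)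
qed

text \<open>The production for \<open>AllI\<close> fires only on a literal \<open>Star\<close>.
  Explicit substitutions around a sequence are therefore pushed into the components, which does not
  change the evaluation.\<close>

lemma seqterm_Suc_steps:
  assumes "seqterm (Suc k) T"
  shows "\<exists>u v. steps c T (Star u v) \<and> structured u \<and> seqterm k v \<and>
    eval_seq T = eval_tm u # eval_seq v"
  using assms
proof (induction "Suc k" T rule: seqterm.induct)
  case (2 u v)
  then show ?case by auto
next
  case (3 T t a)
  then obtain u v where uv: "steps c T (Star u v)" "structured u" "seqterm k v"
    "eval_seq T = eval_tm u # eval_seq v" by blast
  have "steps c (ESub T a t) (ESub (Star u v) a t)"
    using uv(1) by (rule steps_map[where f = "\<lambda>s. ESub s a t", rotated]) (rule step.ESub_1)
  also have "step c (ESub (Star u v) a t) (Star (ESub u a t) (ESub v a t))"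
    by (rule step.ESub_Star)
  finally show ?case using uv 3
    by (intro exI[of _ "ESub u a t"] exI[of _ "ESub v a t"]) (auto intro: structured.intros seqterm.intros)
qed


section \<open>Realizability\<close>

type_synonym 'f val = "'f tm list \<Rightarrow> 'f tm list set"

text \<open>In \<open>yields\<close>, the environment \<open>\<theta>\<close> gives the values of the eigenvariables whose explicit
  substitutions enclose \<open>z\<close>; \<open>W\<close> is the set of variables that may occur in the result.\<close>

definition yields :: "'f \<Rightarrow> (nat \<Rightarrow> 'f tm) \<Rightarrow> nat set \<Rightarrow> ('f, 'p) gtm \<Rightarrow> 'f tm list \<Rightarrow> bool" where
  "yields c \<theta> W z us \<longleftrightarrow> (\<exists>T. steps c z T \<and> seqterm (length us) T \<and>
    map (env_tm \<theta>) (eval_seq T) = us \<and> (\<forall>t\<in>set (eval_seq T). fv_tm t \<subseteq> W))"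

text \<open>The upper bound on \<open>W'\<close> matters as much as the lower one: it stops a
  function from being called in a world containing eigenvariables of the very proof whose
  non-terminal it calls, where an explicit substitution would capture them; see
  \<open>abstr_realizes\<close>.\<close>

definition extends :: "(nat \<Rightarrow> 'f tm) \<Rightarrow> nat set \<Rightarrow> nat set \<Rightarrow> (nat \<Rightarrow> 'f tm) \<Rightarrow> nat set \<Rightarrow> bool" where
  "extends \<theta> W E \<theta>' W' \<longleftrightarrow> env_wf \<theta>' \<and> W \<subseteq> W' \<and> W' \<subseteq> W \<union> E \<and> (\<forall>a\<in>W. \<theta>' a = \<theta> a)"

text \<open>\<open>E\<close> contains the eigenvariables that may still come into scope. A function has to work in all
  extensions of the current world, since it may be called with witnesses containing eigenvariables
  introduced above the inference that passed it as an argument.\<close>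

definition realizes :: "'f \<Rightarrow> (nat \<Rightarrow> 'f tm) \<Rightarrow> nat set \<Rightarrow> nat set \<Rightarrow> ('f, 'p) fm \<Rightarrow> ('f, 'p) gtm \<Rightarrow>
    'f val \<Rightarrow> bool" where
  "realizes c \<theta> W E F z d \<longleftrightarrow> (\<forall>\<theta>' W'. extends \<theta> W E \<theta>' W' \<longrightarrow>
    (\<forall>ts. length ts = arity F \<and> (\<forall>t\<in>set ts. structured t \<and> fv_tm (eval_tm t) \<subseteq> W') \<longrightarrow>
      (\<forall>us \<in> d (map (env_tm \<theta>' \<circ> eval_tm) ts). yields c \<theta>' W' (apps z ts) us)))"

fun realize :: "'f \<Rightarrow> (nat \<Rightarrow> 'f tm) \<Rightarrow> nat set \<Rightarrow> nat set \<Rightarrow> ('f, 'p) fm list \<Rightarrow>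
    ('f, 'p) gtm list \<Rightarrow> 'f val list \<Rightarrow> bool" where
  "realize c \<theta> W E [] [] [] = True"
| "realize c \<theta> W E (F # \<Gamma>) (z # zs) (d # ds) =
    (realizes c \<theta> W E F z d \<and> realize c \<theta> W E \<Gamma> zs ds)"
| "realize c \<theta> W E _ _ _ = False"

text \<open>The environment \<open>\<theta>\<close> fixes the value under discussion,
  \<open>\<theta>'\<close> and \<open>W\<close> the world where the non-terminal is actually called.
  They need to agree only on variables that the proof does not bind itself; disjointness of
  \<open>W\<close> from the eigenvariables protects the arguments from capture.\<close>

definition admissible :: "('f, 'p) lkproof \<Rightarrow> (nat \<Rightarrow> 'f tm) \<Rightarrow> (nat \<Rightarrow> 'f tm) \<Rightarrow> nat set \<Rightarrow> bool" where
  "admissible \<rho> \<theta> \<theta>' W \<longleftrightarrow> env_wf \<theta>' \<and> fv_proof \<rho> - eigenvars \<rho> \<subseteq> W \<and> W \<inter> eigenvars \<rho> = {} \<and>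
    (\<forall>a \<in> fv_proof \<rho> - eigenvars \<rho>. \<theta>' a = \<theta> a)"

text \<open>The results that a non-terminal derives uniformly, from whatever realizers of \<open>ds\<close>. They depend
  on the values of the variables in \<open>\<theta>\<close> but not on the terms representing \<open>ds\<close>.\<close>

definition denote :: "'f \<Rightarrow> ('f, 'p) lkproof \<Rightarrow> ('f, 'p) fm list \<Rightarrow> (nat \<Rightarrow> 'f tm) \<Rightarrow> nat \<Rightarrow>
    'f val list \<Rightarrow> 'f tm list set" where
  "denote c \<rho> \<Gamma> \<theta> i ds = {us. \<forall>\<theta>' W zs. admissible \<rho> \<theta> \<theta>' W \<longrightarrow>
    realize c \<theta>' W (eigenvars \<rho>) \<Gamma> zs ds \<longrightarrow> yields c \<theta>' W (apps (NT \<rho> i) zs) us}"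

abbreviation singleton_val :: "'f tm list \<Rightarrow> 'f val" where
  "singleton_val us \<equiv> \<lambda>_. {us}"

lemma denI:
  "(\<And>\<theta>' W zs. admissible \<rho> \<theta> \<theta>' W \<Longrightarrow> realize c \<theta>' W (eigenvars \<rho>) \<Gamma> zs ds \<Longrightarrow>
    yields c \<theta>' W (apps (NT \<rho> i) zs) us) \<Longrightarrow> us \<in> denote c \<rho> \<Gamma> \<theta> i ds"
  by (simp add: denote_def)

lemma denD:
  "us \<in> denote c \<rho> \<Gamma> \<theta> i ds \<Longrightarrow> admissible \<rho> \<theta> \<theta>' W \<Longrightarrow> realize c \<theta>' W (eigenvars \<rho>) \<Gamma> zs ds \<Longrightarrow>
    yields c \<theta>' W (apps (NT \<rho> i) zs) us"
  by (simp add: denote_def)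

lemma yieldsE:
  assumes "yields c \<theta> W z us"
  obtains T where "steps c z T" "seqterm (length us) T" "map (env_tm \<theta>) (eval_seq T) = us"
    "\<forall>t\<in>set (eval_seq T). fv_tm t \<subseteq> W"
  using assms unfolding yields_def by (elim exE conjE)

lemma yields_steps:
  assumes "steps c z z'" "yields c \<theta> W z' us"
  shows "yields c \<theta> W z us"
proof -
  from assms(2) obtain T where T: "steps c z' T" "seqterm (length us) T"
    "map (env_tm \<theta>) (eval_seq T) = us" "\<forall>t\<in>set (eval_seq T). fv_tm t \<subseteq> W" by (rule yieldsE)
  moreover have "steps c z T" using assms(1) T(1) by (rule rtranclp_trans)
  ultimately show ?thesis unfolding yields_def by (intro exI[of _ T]) simp
qed

lemma yields_production: "production c z z' \<Longrightarrow> yields c \<theta> W z' us \<Longrightarrow> yields c \<theta> W z us"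
  by (meson yields_steps step.Prod r_into_rtranclp)

lemma yields_Unit: "yields c \<theta> W Unit []"
  unfolding yields_def by (intro exI[of _ Unit]) (auto intro: seqterm.intros)

lemma yields_tuple:
  assumes "\<forall>t\<in>set ts. structured t \<and> fv_tm (eval_tm t) \<subseteq> W"
  shows "yields c \<theta> W (tuple ts) (map (env_tm \<theta> \<circ> eval_tm) ts)"
proof -
  have "seqterm (length ts) (tuple ts) \<and> eval_seq (tuple ts) = map eval_tm ts"
    using assms by (induction ts) (auto intro: seqterm.intros)
  then show ?thesis using assms unfolding yields_def
    by (intro exI[of _ "tuple ts"]) auto
qed

lemma yields_Star:
  assumes "structured u" "fv_tm (eval_tm u) \<subseteq> W" "yields c \<theta> W z us"
  shows "yields c \<theta> W (Star u z) (env_tm \<theta> (eval_tm u) # us)"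
proof -
  obtain T where T: "steps c z T" "seqterm (length us) T" "map (env_tm \<theta>) (eval_seq T) = us"
    "\<forall>t\<in>set (eval_seq T). fv_tm t \<subseteq> W" using assms(3) unfolding yields_def by blast
  have "steps c (Star u z) (Star u T)"
    using T(1) by (rule steps_map[rotated]) (rule step.Star_2)
  with T assms show ?thesis unfolding yields_def
    by (intro exI[of _ "Star u T"]) (auto intro: seqterm.intros)
qed

text \<open>Below the substitution, \<open>a\<close> is in scope with the value of \<open>u\<close>;
  outside it has been replaced by \<open>u\<close> in every result, so the scope shrinks back to
  \<open>W\<close>.\<close>

lemma yields_ESub:
  assumes "structured u" "fv_tm (eval_tm u) \<subseteq> W"
    "yields c (\<theta>(a := env_tm \<theta> (eval_tm u))) (insert a W) z us"
  shows "yields c \<theta> W (ESub z a u) us"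
proof -
  obtain T where T: "steps c z T" "seqterm (length us) T"
    "map (env_tm (\<theta>(a := env_tm \<theta> (eval_tm u)))) (eval_seq T) = us"
    "\<forall>t\<in>set (eval_seq T). fv_tm t \<subseteq> insert a W" using assms(3) unfolding yields_def by blast
  have "steps c (ESub z a u) (ESub T a u)"
    using T(1) by (rule steps_map[where f = "\<lambda>s. ESub s a u", rotated]) (rule step.ESub_1)
  moreover have "map (env_tm \<theta>) (eval_seq (ESub T a u)) = us"
    using T(3) by (auto simp: env_tm_subst_tm)
  moreover have "fv_tm (subst_tm a (eval_tm u) t) \<subseteq> W" if "t \<in> set (eval_seq T)" for t
    using that T(4) assms(2) fv_subst_tm[of a "eval_tm u" t] by blast
  ultimately show ?thesis using T assms unfolding yields_def
    by (intro exI[of _ "ESub T a u"]) (auto intro: seqterm.intros)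
qed

lemma yields_Cons:
  assumes "yields c \<theta> W z (s # us)"
  obtains u v where "steps c z (Star u v)" "structured u" "fv_tm (eval_tm u) \<subseteq> W"
    "env_tm \<theta> (eval_tm u) = s" "yields c \<theta> W v us"
proof -
  obtain T where T: "steps c z T" "seqterm (length (s # us)) T"
    "map (env_tm \<theta>) (eval_seq T) = s # us" "\<forall>t\<in>set (eval_seq T). fv_tm t \<subseteq> W"
    using assms by (rule yieldsE)
  obtain u v where uv: "steps c T (Star u v)" "structured u" "seqterm (length us) v"
    "eval_seq T = eval_tm u # eval_seq v" using seqterm_Suc_steps T(2) by (metis length_Cons)
  have "yields c \<theta> W v us" unfolding yields_def using T uv
    by (intro exI[of _ v]) auto
  with T uv show ?thesis by (intro that[of u v]) auto
qed

text \<open>The derivation is the same in both worlds: only evaluation refers to the environment,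
  and the results contain variables from \<open>W\<close> only.\<close>

lemma yields_mono:
  assumes "yields c \<theta> W z us" "extends \<theta> W E \<theta>' W'"
  shows "yields c \<theta>' W' z us"
proof -
  obtain T where T: "steps c z T" "seqterm (length us) T"
    "map (env_tm \<theta>) (eval_seq T) = us" "\<forall>t\<in>set (eval_seq T). fv_tm t \<subseteq> W"
    using assms unfolding yields_def by blast
  have "map (env_tm \<theta>') (eval_seq T) = map (env_tm \<theta>) (eval_seq T)"
    using T(4) assms(2) unfolding extends_def by (intro map_cong refl env_tm_cong) (metis subsetD)
  with T assms(2) show ?thesis unfolding yields_def extends_def
    by (intro exI[of _ T]) auto
qed

lemma realizes_mono:
  assumes "realizes c \<theta> W E F z d" "extends \<theta> W E \<theta>1 W1" "W1 \<union> E1 \<subseteq> W \<union> E"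
  shows "realizes c \<theta>1 W1 E1 F z d"
  unfolding realizes_def
proof (intro allI impI, goal_cases)
  case (1 \<theta>' W' ts)
  have "extends \<theta> W E \<theta>' W'" using assms(2,3) 1(1) unfolding extends_def by auto
  with assms(1) 1(2) show ?case unfolding realizes_def by blast
qed

lemma realize_mono:
  assumes "realize c \<theta> W E \<Gamma> zs ds" "extends \<theta> W E \<theta>1 W1" "W1 \<union> E1 \<subseteq> W \<union> E"
  shows "realize c \<theta>1 W1 E1 \<Gamma> zs ds"
  using assms(1)
proof (induction \<Gamma> arbitrary: zs ds)
  case Nil
  then show ?case by (cases zs; cases ds) auto
next
  case (Cons F \<Gamma>)
  then show ?case by (cases zs; cases ds) (auto intro: realizes_mono[OF _ assms(2,3)])
qed

lemma extends_refl: "env_wf \<theta> \<Longrightarrow> extends \<theta> W E \<theta> W"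
  by (simp add: extends_def)

lemma realizesD:
  assumes "realizes c \<theta> W E F z d" "extends \<theta> W E \<theta>' W'" "length ts = arity F"
    "\<forall>t\<in>set ts. structured t \<and> fv_tm (eval_tm t) \<subseteq> W'" "us \<in> d (map (env_tm \<theta>' \<circ> eval_tm) ts)"
  shows "yields c \<theta>' W' (apps z ts) us"
  using assms unfolding realizes_def by blast

lemma realizes_singleton_val:
  "arity F = 0 \<Longrightarrow> yields c \<theta> W z us \<Longrightarrow> realizes c \<theta> W E F z (singleton_val us)"
  unfolding realizes_def using yields_mono by fastforce

lemma realizes_yields:
  "realizes c \<theta> W E F z d \<Longrightarrow> arity F = 0 \<Longrightarrow> us \<in> d [] \<Longrightarrow> env_wf \<theta> \<Longrightarrow> yields c \<theta> W z us"
  unfolding realizes_def using extends_refl by fastforce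

lemma realize_length: "realize c \<theta> W E \<Gamma> zs ds \<Longrightarrow> length zs = length \<Gamma> \<and> length ds = length \<Gamma>"
  by (induction c \<theta> W E \<Gamma> zs ds rule: realize.induct) auto

lemma realize_Cons:
  "realize c \<theta> W E (F # \<Gamma>) zs (d # ds) \<longleftrightarrow>
    (\<exists>z zs'. zs = z # zs' \<and> realizes c \<theta> W E F z d \<and> realize c \<theta> W E \<Gamma> zs' ds)"
  by (cases zs) auto

lemma realize_Nil: "realize c \<theta> W E [] zs [] \<longleftrightarrow> zs = []"
  by (cases zs) auto

lemma realize_append:
  "length ds = length \<Gamma> \<Longrightarrow> realize c \<theta> W E (\<Gamma> @ \<Delta>) zs (ds @ es) \<longleftrightarrow>
    (\<exists>xs ys. zs = xs @ ys \<and> realize c \<theta> W E \<Gamma> xs ds \<and> realize c \<theta> W E \<Delta> ys es)"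
proof (induction \<Gamma> arbitrary: zs ds)
  case Nil
  then show ?case by (auto simp: realize_Nil)
next
  case (Cons F \<Gamma>)
  then obtain d ds' where "ds = d # ds'" "length ds' = length \<Gamma>" by (cases ds) auto
  with Cons.IH show ?case by (auto simp: realize_Cons) (metis append_Cons)+
qed

section \<open>Counter-witnesses, winning and totality\<close>

definition witness :: "('f, 'p) fm \<Rightarrow> 'f tm list \<Rightarrow> bool" where
  "witness F us \<longleftrightarrow> length us = n_ex F \<and> (\<forall>t\<in>set us. wf_tm 0 t)"

text \<open>Counter-witnesses. The value at \<open>[]\<close> is used if the formula is not a proper \<open>\<Sigma>\<^sub>2\<close> formula.
  Functions must be total: the last existential inference of a block evaluates them, so that otherwise
  no result would be derived.\<close>

definition counter :: "('f, 'p) fm \<Rightarrow> 'f val \<Rightarrow> bool" where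
  "counter F d \<longleftrightarrow> (\<forall>s. length s = arity F \<and> (\<forall>t\<in>set s. wf_tm 0 t) \<longrightarrow>
      d s \<noteq> {} \<and> (\<forall>us\<in>d s. witness (dual F) us)) \<and>
    (\<not> is_sigma2 F \<longrightarrow> (\<exists>s. d [] = {s}))"

text \<open>The lists are concatenated in quantifier order: for a proper Sigma_2 formula the
  counter-witness answers after \<open>us\<close>, otherwise it comes first. Beating all answers is
  what a cut exploits, as the refuting answer is just some member of the set.\<close>

definition wins :: "('p \<Rightarrow> 'f tm list \<Rightarrow> bool) \<Rightarrow> ('f, 'p) fm \<Rightarrow> 'f val \<Rightarrow> 'f tm list \<Rightarrow> bool" where
  "wins v F d us \<longleftrightarrow> witness F us \<and>
    (if is_sigma2 F then \<forall>ws\<in>d us. holds v (full_inst F (us @ ws))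
     else \<forall>ws\<in>d []. holds v (full_inst F (ws @ us)))"

text \<open>Says nothing about truth. It guarantees that the function handed over at a cut has an
  answer to every argument, as \<open>cut_val_counter\<close> requires.\<close>

definition total :: "'f \<Rightarrow> ('f, 'p) lkproof \<Rightarrow> ('f, 'p) fm list \<Rightarrow> (nat \<Rightarrow> 'f tm) \<Rightarrow> 'f val list \<Rightarrow> bool" where
  "total c \<rho> \<Gamma> \<theta> ds \<longleftrightarrow> (\<forall>i<length \<Gamma>. \<exists>us\<in>denote c \<rho> \<Gamma> \<theta> i ds. witness (\<Gamma> ! i) us)"

definition winning :: "'f \<Rightarrow> ('f, 'p) lkproof \<Rightarrow> ('f, 'p) fm list \<Rightarrow> (nat \<Rightarrow> 'f tm) \<Rightarrow> 'f val list \<Rightarrow> bool" where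
  "winning c \<rho> \<Gamma> \<theta> ds \<longleftrightarrow>
    (\<forall>v. \<exists>i<length \<Gamma>. \<exists>us\<in>denote c \<rho> \<Gamma> \<theta> i ds. wins v (env_fm \<theta> (\<Gamma> ! i)) (ds ! i) us)"

definition sound :: "'f \<Rightarrow> ('f, 'p) lkproof \<Rightarrow> ('f, 'p) fm list \<Rightarrow> bool" where
  "sound c \<rho> \<Gamma> \<longleftrightarrow> (\<forall>\<theta> ds. env_wf \<theta> \<longrightarrow> list_all2 counter \<Gamma> ds \<longrightarrow>
    total c \<rho> \<Gamma> \<theta> ds \<and> winning c \<rho> \<Gamma> \<theta> ds)"

lemma soundI:
  assumes "\<And>\<theta> ds. env_wf \<theta> \<Longrightarrow> list_all2 counter \<Gamma> ds \<Longrightarrow> total c \<rho> \<Gamma> \<theta> ds"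
    and "\<And>\<theta> ds. env_wf \<theta> \<Longrightarrow> list_all2 counter \<Gamma> ds \<Longrightarrow> winning c \<rho> \<Gamma> \<theta> ds"
  shows "sound c \<rho> \<Gamma>"
  using assms by (simp add: sound_def)

lemma soundD:
  assumes "sound c \<rho> \<Gamma>" "env_wf \<theta>" "list_all2 counter \<Gamma> ds"
  shows "total c \<rho> \<Gamma> \<theta> ds" "winning c \<rho> \<Gamma> \<theta> ds"
  using assms by (simp_all add: sound_def)

lemma totalI:
  "(\<And>i. i < length \<Gamma> \<Longrightarrow> \<exists>us\<in>denote c \<rho> \<Gamma> \<theta> i ds. witness (\<Gamma> ! i) us) \<Longrightarrow> total c \<rho> \<Gamma> \<theta> ds"
  by (simp add: total_def)

lemma totalD:
  assumes "total c \<rho> \<Gamma> \<theta> ds" "i < length \<Gamma>"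
  obtains us where "us \<in> denote c \<rho> \<Gamma> \<theta> i ds" "witness (\<Gamma> ! i) us"
  using assms by (auto simp: total_def)

lemma winningI:
  "(\<And>v. \<exists>i<length \<Gamma>. \<exists>us\<in>denote c \<rho> \<Gamma> \<theta> i ds. wins v (env_fm \<theta> (\<Gamma> ! i)) (ds ! i) us) \<Longrightarrow>
    winning c \<rho> \<Gamma> \<theta> ds"
  by (simp add: winning_def)

lemma winningD:
  assumes "winning c \<rho> \<Gamma> \<theta> ds"
  obtains i us where "i < length \<Gamma>" "us \<in> denote c \<rho> \<Gamma> \<theta> i ds" "wins v (env_fm \<theta> (\<Gamma> ! i)) (ds ! i) us"
  using assms unfolding winning_def by blast

lemma full_inst_qfree: "qfree F \<Longrightarrow> full_inst F ts = F"
  by (cases F) auto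

lemma witness_qfree: "qfree F \<Longrightarrow> witness F us \<longleftrightarrow> us = []"
  using qfree_counts[of F] by (auto simp: witness_def)

lemma witness_env_fm [simp]: "witness (env_fm \<theta> F) = witness F"
  by (simp add: witness_def fun_eq_iff)

lemma witness_inst [simp]: "witness (inst k r F) = witness F"
  by (simp add: witness_def fun_eq_iff)

lemma witness_Cons: "witness (Exists A) (t # us) \<longleftrightarrow> wf_tm 0 t \<and> witness A us"
  by (auto simp: witness_def)

lemma wins_witness: "wins v F d us \<Longrightarrow> witness F us"
  by (simp add: wins_def)

lemma okD:
  assumes "counter F d" "length s = arity F" "\<forall>t\<in>set s. wf_tm 0 t"
  shows "d s \<noteq> {}" "us \<in> d s \<Longrightarrow> witness (dual F) us"
  using assms unfolding counter_def by blast+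

lemma counter_singleton_val: "\<not> is_sigma2 F \<Longrightarrow> witness (dual F) s \<Longrightarrow> counter F (singleton_val s)"
  by (simp add: counter_def arity_def)

lemma counter_not_fun:
  assumes "counter F d" "\<not> is_sigma2 F"
  obtains s where "d [] = {s}" "witness (dual F) s"
  using assms by (auto simp: counter_def arity_def)

lemma counter_inst [simp]: "counter (inst k r F) = counter F"
  by (simp add: counter_def fun_eq_iff dual_inst)

lemma counter_qfree:
  assumes "counter F d" "qfree F"
  shows "d [] = {[]}"
  using assms by (metis witness_qfree is_sigma2_qfree counter_not_fun qfree_dual)

lemma wins_qfree:
  assumes "qfree F" "counter F d"
  shows "wins v (env_fm \<theta> F) d us \<longleftrightarrow> us = [] \<and> holds v (env_fm \<theta> F)"
  using assms counter_qfree[OF assms(2,1)] is_sigma2_qfree[OF assms(1)]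
  by (auto simp: wins_def witness_qfree full_inst_qfree)

lemma counter_singleton_val_qfree: "qfree F \<Longrightarrow> counter F (singleton_val [])"
  by (rule counter_singleton_val) (auto simp: is_sigma2_qfree witness_qfree)

lemma arity_qfree: "qfree F \<Longrightarrow> arity F = 0"
  by (simp add: arity_def is_sigma2_qfree)

lemma realizes_Unit: "qfree F \<Longrightarrow> realizes c \<theta> W E F Unit (singleton_val [])"
  by (rule realizes_singleton_val) (auto simp: arity_qfree yields_Unit)


section \<open>Soundness of the inference rules\<close>

lemma eigenvars_fv_proof: "eigenvars \<rho> \<subseteq> fv_proof \<rho>"
  by (induction \<rho>) auto

text \<open>A variable free in the premise must not become bound by a substitution of another
  branch; this is where regularity enters for rules with two premises. \<open>AllI\<close> is absent
  from \<open>premise_of_rules\<close>: its eigenvariable may be free in the premise, so there the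
  world has to change.\<close>

definition premise_of :: "('f, 'p) lkproof \<Rightarrow> ('f, 'p) lkproof \<Rightarrow> bool" where
  "premise_of \<rho>' \<rho> \<longleftrightarrow> eigenvars \<rho>' \<subseteq> eigenvars \<rho> \<and>
    fv_proof \<rho>' - eigenvars \<rho>' \<subseteq> fv_proof \<rho> - eigenvars \<rho>"

lemma premise_of_rules:
  "premise_of \<rho> (OrI \<rho>)" "premise_of \<rho> (Contr \<rho>)" "premise_of \<rho> (Perm k \<rho>)"
  "regular (ExI A r \<rho>) \<Longrightarrow> premise_of \<rho> (ExI A r \<rho>)" "regular (Weak A \<rho>) \<Longrightarrow> premise_of \<rho> (Weak A \<rho>)"
  "regular (AndI \<rho>\<^sub>0 \<rho>\<^sub>1) \<Longrightarrow> premise_of \<rho>\<^sub>0 (AndI \<rho>\<^sub>0 \<rho>\<^sub>1)" "regular (AndI \<rho>\<^sub>0 \<rho>\<^sub>1) \<Longrightarrow> premise_of \<rho>\<^sub>1 (AndI \<rho>\<^sub>0 \<rho>\<^sub>1)"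
  "regular (Cut A \<rho>\<^sub>0 \<rho>\<^sub>1) \<Longrightarrow> premise_of \<rho>\<^sub>0 (Cut A \<rho>\<^sub>0 \<rho>\<^sub>1)" "regular (Cut A \<rho>\<^sub>0 \<rho>\<^sub>1) \<Longrightarrow> premise_of \<rho>\<^sub>1 (Cut A \<rho>\<^sub>0 \<rho>\<^sub>1)"
  by (auto simp: premise_of_def)

lemma premise_of_admissible: "premise_of \<rho>' \<rho> \<Longrightarrow> admissible \<rho> \<theta> \<theta>' W \<Longrightarrow> admissible \<rho>' \<theta> \<theta>' W"
  unfolding premise_of_def admissible_def by blast

lemma premise_of_realize:
  "premise_of \<rho>' \<rho> \<Longrightarrow> env_wf \<theta> \<Longrightarrow> realize c \<theta> W (eigenvars \<rho>) \<Gamma> zs ds \<Longrightarrow>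
    realize c \<theta> W (eigenvars \<rho>') \<Gamma> zs ds"
  by (rule realize_mono) (auto simp: premise_of_def extends_refl)

lemma admissible_env: "admissible \<rho> \<theta> \<theta>' W \<Longrightarrow> env_wf \<theta>'"
  by (simp add: admissible_def)

text \<open>The common pattern of productions that merely call a non-terminal of the premise: the
  world stays fixed, so it suffices to turn realizers for the conclusion into realizers for the
  premise.\<close>

lemma denote_premise:
  assumes "us \<in> denote c \<rho>' \<Gamma>' \<theta> j ds'" "premise_of \<rho>' \<rho>"
    and "\<And>\<theta>' W zs. admissible \<rho> \<theta> \<theta>' W \<Longrightarrow> realize c \<theta>' W (eigenvars \<rho>') \<Gamma> zs ds \<Longrightarrow>
      \<exists>zs'. production c (apps (NT \<rho> i) zs) (apps (NT \<rho>' j) zs') \<and>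
        realize c \<theta>' W (eigenvars \<rho>') \<Gamma>' zs' ds'"
  shows "us \<in> denote c \<rho> \<Gamma> \<theta> i ds"
proof (rule denI)
  fix \<theta>' W zs
  assume *: "admissible \<rho> \<theta> \<theta>' W" "realize c \<theta>' W (eigenvars \<rho>) \<Gamma> zs ds"
  then have "realize c \<theta>' W (eigenvars \<rho>') \<Gamma> zs ds"
    by (meson admissible_env assms(2) premise_of_realize)
  with * assms(3) obtain zs' where "production c (apps (NT \<rho> i) zs) (apps (NT \<rho>' j) zs')"
    "realize c \<theta>' W (eigenvars \<rho>') \<Gamma>' zs' ds'" by blast
  then show "yields c \<theta>' W (apps (NT \<rho> i) zs) us"
    by (meson "*"(1) assms(1,2) denD premise_of_admissible yields_production)
qed

lemma index_append:
  assumes "i < length (xs @ ys)"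
  obtains "i < length xs" | j where "i = length xs + j" "j < length ys"
proof (cases "i < length xs")
  case False
  then show ?thesis using assms that(2)[of "i - length xs"] by auto
qed (use that in auto)

section \<open>Axiom and propositional rules\<close>

lemma sound_Ax: "sound c (Ax p ts) [Lit False p ts, Lit True p ts]"
proof -
  have denote: "[] \<in> denote c (Ax p ts) [Lit False p ts, Lit True p ts] \<theta> i ds"
    if ds: "list_all2 counter [Lit False p ts, Lit True p ts] ds" and i: "i < 2"
    for \<theta> i and ds :: "'a val list"
  proof (rule denI)
    fix \<theta>' W zs
    assume *: "admissible (Ax p ts) \<theta> \<theta>' W"
      "realize c \<theta>' W (eigenvars (Ax p ts)) [Lit False p ts, Lit True p ts] zs ds"
    obtain d0 d1 where d: "ds = [d0, d1]" "counter (Lit False p ts) d0" "counter (Lit True p ts) d1"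
      using ds by (auto simp: list_all2_Cons1)
    have d': "[] \<in> d0 []" "[] \<in> d1 []" using counter_qfree[OF d(2)] counter_qfree[OF d(3)] by simp_all
    obtain z0 z1 where z: "zs = [z0, z1]" "realizes c \<theta>' W {} (Lit False p ts) z0 d0"
      "realizes c \<theta>' W {} (Lit True p ts) z1 d1"
      using *(2) d(1) by (auto simp: realize_Cons realize_Nil)
    have y: "yields c \<theta>' W z0 []" "yields c \<theta>' W z1 []"
      using z(2,3) d' admissible_env[OF *(1)] by (auto intro!: realizes_yields simp: arity_qfree)
    show "yields c \<theta>' W (apps (NT (Ax p ts) i) zs) []"
    proof (cases i)
      case 0
      then show ?thesis using y z(1)
        by (auto intro: yields_production[OF production.Ax_0] simp del: apps_simps)
    next
      case (Suc n)
      then have i1: "i = 1" using i by simp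
      show ?thesis unfolding z(1) i1 by (rule yields_production[OF production.Ax_1 y(1)])
    qed
  qed
  show ?thesis
  proof (rule soundI)
    fix \<theta> :: "nat \<Rightarrow> 'a tm" and ds :: "'a val list"
    assume ds: "list_all2 counter [Lit False p ts, Lit True p ts] ds"
    show "total c (Ax p ts) [Lit False p ts, Lit True p ts] \<theta> ds"
      by (intro totalI bexI[of _ "[]"] denote[OF ds]) (auto simp: witness_qfree less_Suc_eq)
    obtain d0 d1 where d: "ds = [d0, d1]" "counter (Lit False p ts) d0" "counter (Lit True p ts) d1"
      using ds by (auto simp: list_all2_Cons1)
    show "winning c (Ax p ts) [Lit False p ts, Lit True p ts] \<theta> ds"
    proof (rule winningI)
      fix v
      \<comment> \<open>The position of the literal that is true under \<open>v\<close>.\<close>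
      let ?i = "if v p (map (env_tm \<theta>) ts) then 1 else 0 :: nat"
      have "wins v (env_fm \<theta> ([Lit False p ts, Lit True p ts] ! ?i)) (ds ! ?i) []"
        using d wins_qfree[of "[Lit False p ts, Lit True p ts] ! ?i" "ds ! ?i"] by auto
      with denote[OF ds, of ?i] show "\<exists>i<length [Lit False p ts, Lit True p ts].
        \<exists>us\<in>denote c (Ax p ts) [Lit False p ts, Lit True p ts] \<theta> i ds.
          wins v (env_fm \<theta> ([Lit False p ts, Lit True p ts] ! i)) (ds ! i) us"
        by (intro exI[of _ ?i]) auto
    qed
  qed
qed

lemma sound_OrI:
  assumes der: "\<rho> \<turnstile> A # B # \<Gamma>" and IH: "sound c \<rho> (A # B # \<Gamma>)" and pnx: "prenex2 (Or A B)"
  shows "sound c (OrI \<rho>) (Or A B # \<Gamma>)"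
proof -
  have qf: "qfree A" "qfree B" using prenex2_Or[OF pnx] by auto
  have denote0: "[] \<in> denote c (OrI \<rho>) (Or A B # \<Gamma>) \<theta> 0 (d # ds)" for \<theta> d ds
    by (rule denI, unfold realize_Cons)
      (metis Or_0 der realize_length yields_Unit yields_production)
  have denS: "us \<in> denote c (OrI \<rho>) (Or A B # \<Gamma>) \<theta> (Suc i) (d # ds)"
    if "us \<in> denote c \<rho> (A # B # \<Gamma>) \<theta> (Suc (Suc i)) (singleton_val [] # singleton_val [] # ds)" "i < length \<Gamma>"
    for us \<theta> i d ds
  proof (rule denote_premise[OF that(1) premise_of_rules(1)])
    fix \<theta>' W zs
    assume "realize c \<theta>' W (eigenvars \<rho>) (Or A B # \<Gamma>) zs (d # ds)"
    then obtain z ys where zs: "zs = z # ys" "realize c \<theta>' W (eigenvars \<rho>) \<Gamma> ys ds"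
      by (auto simp: realize_Cons)
    then show "\<exists>zs'. production c (apps (NT (OrI \<rho>) (Suc i)) zs) (apps (NT \<rho> (Suc (Suc i))) zs') \<and>
        realize c \<theta>' W (eigenvars \<rho>) (A # B # \<Gamma>) zs' (singleton_val [] # singleton_val [] # ds)"
      using production.Or_Suc[OF der, of ys "Suc i" c z] that(2) qf realize_length[OF zs(2)]
      by (intro exI[of _ "Unit # Unit # ys"]) (auto simp: realizes_Unit)
  qed
  show ?thesis
  proof (rule soundI)
    fix \<theta> :: "nat \<Rightarrow> 'a tm" and ds0 :: "'a val list"
    assume env: "env_wf \<theta>" and "list_all2 counter (Or A B # \<Gamma>) ds0"
    then obtain d ds where ds: "ds0 = d # ds" "counter (Or A B) d" "list_all2 counter \<Gamma> ds"
      by (auto simp: list_all2_Cons1)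
    have "list_all2 counter (A # B # \<Gamma>) (singleton_val [] # singleton_val [] # ds)"
      using ds qf by (simp add: counter_singleton_val_qfree)
    note IH' = soundD[OF IH env this]
    show "total c (OrI \<rho>) (Or A B # \<Gamma>) \<theta> ds0"
    proof (rule totalI)
      fix i assume i: "i < length (Or A B # \<Gamma>)"
      show "\<exists>us\<in>denote c (OrI \<rho>) (Or A B # \<Gamma>) \<theta> i ds0. witness ((Or A B # \<Gamma>) ! i) us"
      proof (cases i)
        case 0
        then show ?thesis using denote0 ds(1) qf by (intro bexI[of _ "[]"]) (auto simp: witness_qfree)
      next
        case (Suc j)
        obtain us where "us \<in> denote c \<rho> (A # B # \<Gamma>) \<theta> (Suc (Suc j)) (singleton_val [] # singleton_val [] # ds)"
          "witness ((A # B # \<Gamma>) ! Suc (Suc j)) us" using i Suc by (auto intro: totalD[OF IH'(1), of "Suc (Suc j)"])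
        then show ?thesis using Suc i denS ds(1) by auto
      qed
    qed
    show "winning c (OrI \<rho>) (Or A B # \<Gamma>) \<theta> ds0"
    proof (rule winningI)
      fix v
      obtain j us where j: "j < length (A # B # \<Gamma>)"
        "us \<in> denote c \<rho> (A # B # \<Gamma>) \<theta> j (singleton_val [] # singleton_val [] # ds)"
        "wins v (env_fm \<theta> ((A # B # \<Gamma>) ! j)) ((singleton_val [] # singleton_val [] # ds) ! j) us"
        using winningD[OF IH'(2)] by blast
      show "\<exists>i<length (Or A B # \<Gamma>). \<exists>us\<in>denote c (OrI \<rho>) (Or A B # \<Gamma>) \<theta> i ds0.
        wins v (env_fm \<theta> ((Or A B # \<Gamma>) ! i)) (ds0 ! i) us"
      \<comment> \<open>A winner at index 0 or 1 is a true disjunct; all other indices belong to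
        side formulas.\<close>
      proof (cases "j < 2")
        case True
        then have "holds v (env_fm \<theta> A) \<or> holds v (env_fm \<theta> B)"
          using j(3) qf wins_qfree counter_singleton_val_qfree by (fastforce simp: less_2_cases_iff)
        then have "wins v (env_fm \<theta> (Or A B)) d []"
          using qf ds(2) wins_qfree[of "Or A B" d] by auto
        then show ?thesis using denote0 ds(1) by (intro exI[of _ 0]) auto
      next
        case False
        then obtain i where "j = Suc (Suc i)"
          by (metis add_2_eq_Suc le_Suc_ex not_less)
        then show ?thesis using j denS ds(1) by (intro exI[of _ "Suc i"]) auto
      qed
    qed
  qed
qed

lemma sound_AndI:
  assumes der: "\<rho>\<^sub>0 \<turnstile> A # \<Gamma>" "\<rho>\<^sub>1 \<turnstile> B # \<Delta>"
    and IH: "sound c \<rho>\<^sub>0 (A # \<Gamma>)" "sound c \<rho>\<^sub>1 (B # \<Delta>)"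
    and pnx: "prenex2 (And A B)" and reg: "regular (AndI \<rho>\<^sub>0 \<rho>\<^sub>1)"
  shows "sound c (AndI \<rho>\<^sub>0 \<rho>\<^sub>1) (And A B # \<Gamma> @ \<Delta>)"
proof -
  have qf: "qfree A" "qfree B" using prenex2_And[OF pnx] by auto
  let ?\<rho> = "AndI \<rho>\<^sub>0 \<rho>\<^sub>1"
  have split: "\<exists>z zx zy. zs = z # zx @ zy \<and> realize c \<theta> W E \<Gamma> zx xs \<and> realize c \<theta> W E \<Delta> zy ys \<and>
      length zx = length \<Gamma> \<and> length zy = length \<Delta>"
    if rl: "realize c \<theta> W E (And A B # \<Gamma> @ \<Delta>) zs (d # xs @ ys)" and len: "length xs = length \<Gamma>"
    for \<theta> W E zs d xs ys
  proof -
    obtain z zs' where z: "zs = z # zs'" "realize c \<theta> W E (\<Gamma> @ \<Delta>) zs' (xs @ ys)"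
      using rl by (auto simp: realize_Cons)
    then obtain zx zy where "zs' = zx @ zy" "realize c \<theta> W E \<Gamma> zx xs" "realize c \<theta> W E \<Delta> zy ys"
      using len by (auto simp: realize_append)
    with z show ?thesis by (intro exI[of _ z] exI[of _ zx] exI[of _ zy]) (auto dest: realize_length)
  qed
  have denote0: "[] \<in> denote c ?\<rho> (And A B # \<Gamma> @ \<Delta>) \<theta> 0 (d # xs @ ys)" if "length xs = length \<Gamma>"
    for \<theta> d xs ys
  proof (rule denI)
    fix \<theta>' W zs
    assume "realize c \<theta>' W (eigenvars ?\<rho>) (And A B # \<Gamma> @ \<Delta>) zs (d # xs @ ys)"
    from split[OF this that] obtain z zx zy where "zs = z # zx @ zy"
      "length zx = length \<Gamma>" "length zy = length \<Delta>" by blast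
    then show "yields c \<theta>' W (apps (NT ?\<rho> 0) zs) []"
      by (auto intro!: yields_production[OF production.And_0[OF der]] yields_Unit simp del: apps_simps)
  qed
  have denL: "us \<in> denote c ?\<rho> (And A B # \<Gamma> @ \<Delta>) \<theta> (Suc i) (d # xs @ ys)"
    if "us \<in> denote c \<rho>\<^sub>0 (A # \<Gamma>) \<theta> (Suc i) (singleton_val [] # xs)" "i < length \<Gamma>" "length xs = length \<Gamma>"
    for us \<theta> i d xs ys
  proof (rule denote_premise[OF that(1) premise_of_rules(6)[OF reg]])
    fix \<theta>' W zs
    assume "realize c \<theta>' W (eigenvars \<rho>\<^sub>0) (And A B # \<Gamma> @ \<Delta>) zs (d # xs @ ys)"
    from split[OF this that(3)] obtain z zx zy where zs: "zs = z # zx @ zy"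
      "realize c \<theta>' W (eigenvars \<rho>\<^sub>0) \<Gamma> zx xs" "length zx = length \<Gamma>" "length zy = length \<Delta>" by blast
    then show "\<exists>zs'. production c (apps (NT ?\<rho> (Suc i)) zs) (apps (NT \<rho>\<^sub>0 (Suc i)) zs') \<and>
        realize c \<theta>' W (eigenvars \<rho>\<^sub>0) (A # \<Gamma>) zs' (singleton_val [] # xs)"
      using production.And_left[OF der zs(3,4), of "Suc i" c z] that(2) qf
      by (intro exI[of _ "Unit # zx"]) (auto simp: realizes_Unit)
  qed
  have denR: "us \<in> denote c ?\<rho> (And A B # \<Gamma> @ \<Delta>) \<theta> (Suc (length \<Gamma> + i)) (d # xs @ ys)"
    if "us \<in> denote c \<rho>\<^sub>1 (B # \<Delta>) \<theta> (Suc i) (singleton_val [] # ys)" "i < length \<Delta>" "length xs = length \<Gamma>"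
    for us \<theta> i d xs ys
  proof (rule denote_premise[OF that(1) premise_of_rules(7)[OF reg]])
    fix \<theta>' W zs
    assume "realize c \<theta>' W (eigenvars \<rho>\<^sub>1) (And A B # \<Gamma> @ \<Delta>) zs (d # xs @ ys)"
    from split[OF this that(3)] obtain z zx zy where zs: "zs = z # zx @ zy"
      "realize c \<theta>' W (eigenvars \<rho>\<^sub>1) \<Delta> zy ys" "length zx = length \<Gamma>" "length zy = length \<Delta>" by blast
    then show "\<exists>zs'. production c (apps (NT ?\<rho> (Suc (length \<Gamma> + i))) zs) (apps (NT \<rho>\<^sub>1 (Suc i)) zs') \<and>
        realize c \<theta>' W (eigenvars \<rho>\<^sub>1) (B # \<Delta>) zs' (singleton_val [] # ys)"
      using production.And_right[OF der zs(3,4), of "Suc (length \<Gamma> + i)" c z] that(2) qf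
      by (intro exI[of _ "Unit # zy"]) (auto simp: realizes_Unit Suc_diff_le)
  qed
  show ?thesis
  proof (rule soundI)
    fix \<theta> :: "nat \<Rightarrow> 'a tm" and ds0 :: "'a val list"
    assume env: "env_wf \<theta>" and "list_all2 counter (And A B # \<Gamma> @ \<Delta>) ds0"
    then obtain d xs ys where ds: "ds0 = d # xs @ ys" "counter (And A B) d"
      "list_all2 counter \<Gamma> xs" "list_all2 counter \<Delta> ys"
      by (auto simp: list_all2_Cons1 list_all2_append1)
    note len = list_all2_lengthD[OF ds(3), symmetric] list_all2_lengthD[OF ds(4), symmetric]
    have "list_all2 counter (A # \<Gamma>) (singleton_val [] # xs)" "list_all2 counter (B # \<Delta>) (singleton_val [] # ys)"
      using ds qf by (simp_all add: counter_singleton_val_qfree)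
    note IH0 = soundD[OF IH(1) env this(1)] and IH1 = soundD[OF IH(2) env this(2)]
    show "total c ?\<rho> (And A B # \<Gamma> @ \<Delta>) \<theta> ds0"
    proof (rule totalI)
      fix i assume i: "i < length (And A B # \<Gamma> @ \<Delta>)"
      consider "i = 0" | j where "i = Suc j" "j < length \<Gamma>"
        | j where "i = Suc (length \<Gamma> + j)" "j < length \<Delta>"
      proof (cases i)
        case (Suc k)
        then have "k < length (\<Gamma> @ \<Delta>)" using i by simp
        then show ?thesis by (rule index_append) (use Suc that in auto)
      qed (use that in auto)
      then show "\<exists>us\<in>denote c ?\<rho> (And A B # \<Gamma> @ \<Delta>) \<theta> i ds0. witness ((And A B # \<Gamma> @ \<Delta>) ! i) us"
      proof cases
        case 1
        then show ?thesis using denote0 ds(1) qf len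
          by (intro bexI[of _ "[]"]) (auto simp: witness_qfree)
      next
        case 2
        then obtain us where "us \<in> denote c \<rho>\<^sub>0 (A # \<Gamma>) \<theta> (Suc j) (singleton_val [] # xs)"
          "witness ((A # \<Gamma>) ! Suc j) us" by (auto intro: totalD[OF IH0(1), of "Suc j"])
        then show ?thesis using 2 denL ds(1) len by (auto simp: nth_append)
      next
        case 3
        then obtain us where "us \<in> denote c \<rho>\<^sub>1 (B # \<Delta>) \<theta> (Suc j) (singleton_val [] # ys)"
          "witness ((B # \<Delta>) ! Suc j) us" by (auto intro: totalD[OF IH1(1), of "Suc j"])
        then show ?thesis using 3 denR ds(1) len by (auto simp: nth_append)
      qed
    qed
    show "winning c ?\<rho> (And A B # \<Gamma> @ \<Delta>) \<theta> ds0"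
    proof (rule winningI)
      fix v
      obtain j us where j: "j < length (A # \<Gamma>)"
        "us \<in> denote c \<rho>\<^sub>0 (A # \<Gamma>) \<theta> j (singleton_val [] # xs)"
        "wins v (env_fm \<theta> ((A # \<Gamma>) ! j)) ((singleton_val [] # xs) ! j) us"
        using winningD[OF IH0(2)] by blast
      obtain k ws where k: "k < length (B # \<Delta>)"
        "ws \<in> denote c \<rho>\<^sub>1 (B # \<Delta>) \<theta> k (singleton_val [] # ys)"
        "wins v (env_fm \<theta> ((B # \<Delta>) ! k)) ((singleton_val [] # ys) ! k) ws"
        using winningD[OF IH1(2)] by blast
      \<comment> \<open>A winning side formula of either premise suffices; only if both premises win
        at their principal formulas is the conjunction needed, and then it is true.\<close>
      consider i where "j = Suc i" | i where "k = Suc i" | "j = 0" "k = 0"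
        by (cases j; cases k) auto
      then show "\<exists>i<length (And A B # \<Gamma> @ \<Delta>). \<exists>us\<in>denote c ?\<rho> (And A B # \<Gamma> @ \<Delta>) \<theta> i ds0.
        wins v (env_fm \<theta> ((And A B # \<Gamma> @ \<Delta>) ! i)) (ds0 ! i) us"
      proof cases
        case (1 i)
        then show ?thesis using j denL ds(1) len
          by (intro exI[of _ "Suc i"]) (auto simp: nth_append)
      next
        case (2 i)
        then show ?thesis using k denR ds(1) len
          by (intro exI[of _ "Suc (length \<Gamma> + i)"]) (auto simp: nth_append)
      next
        case 3
        then have "holds v (env_fm \<theta> A)" "holds v (env_fm \<theta> B)"
          using j(3) k(3) wins_qfree[OF qf(1) counter_singleton_val_qfree[OF qf(1)]]
            wins_qfree[OF qf(2) counter_singleton_val_qfree[OF qf(2)]] by auto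
        then have "wins v (env_fm \<theta> (And A B)) d []"
          using qf ds(2) wins_qfree[of "And A B" d] by auto
        then show ?thesis using denote0 ds(1) len by (intro exI[of _ 0]) auto
      qed
    qed
  qed
qed

section \<open>Quantifier rules\<close>

lemma sound_AllI:
  assumes der: "AllI \<alpha> A \<rho> \<turnstile> Forall A # \<Gamma>" and fresh: "\<alpha> \<notin> fv A" "\<forall>B\<in>set \<Gamma>. \<alpha> \<notin> fv B"
    and IH: "sound c \<rho> (inst 0 (Free \<alpha>) A # \<Gamma>)"
    and pnx: "prenex2 (Forall A)" and reg: "regular (AllI \<alpha> A \<rho>)"
  shows "sound c (AllI \<alpha> A \<rho>) (Forall A # \<Gamma>)"
proof -
  let ?\<rho> = "AllI \<alpha> A \<rho>" and ?A = "inst 0 (Free \<alpha>) A"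
  have nf: "\<not> is_sigma2 A" using prenex2_Forall[OF pnx] by blast
  \<comment> \<open>The counter-witness for \<open>Forall A\<close> is split: its head
    \<open>s0\<close> becomes the value of \<open>\<alpha>\<close>, its tail \<open>s1\<close> the
    counter-witness for the instance.\<close>
  have denote: "us \<in> denote c ?\<rho> (Forall A # \<Gamma>) \<theta> i (d # ds)"
    if us: "us \<in> denote c \<rho> (?A # \<Gamma>) (\<theta>(\<alpha> := s0)) i (singleton_val s1 # ds)" and d: "d [] = {s0 # s1}"
      and i: "i \<le> length \<Gamma>" and s0: "wf_tm 0 s0"
    for us \<theta> i d ds s0 s1
  proof (rule denI)
    fix \<theta>' W zs
    assume adm: "admissible ?\<rho> \<theta> \<theta>' W"
      and "realize c \<theta>' W (eigenvars ?\<rho>) (Forall A # \<Gamma>) zs (d # ds)"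
    then obtain z ys where zs: "zs = z # ys" "realizes c \<theta>' W (eigenvars ?\<rho>) (Forall A) z d"
      "realize c \<theta>' W (eigenvars ?\<rho>) \<Gamma> ys ds" by (auto simp: realize_Cons)
    have len: "length ys = length \<Gamma>" using realize_length[OF zs(3)] by simp
    note env = admissible_env[OF adm]
    have "yields c \<theta>' W z (s0 # s1)"
      using zs(2) by (rule realizes_yields) (auto simp: arity_def d env)
    \<comment> \<open>The argument is first reduced to a literal \<open>Star\<close>, the only form
      on which the production fires.\<close>
    then obtain u w where uw: "steps c z (Star u w)" "structured u" "fv_tm (eval_tm u) \<subseteq> W"
      "env_tm \<theta>' (eval_tm u) = s0" "yields c \<theta>' W w s1" by (rule yields_Cons)
    let ?\<theta> = "\<theta>'(\<alpha> := s0)" and ?W = "insert \<alpha> W"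
    have \<alpha>: "\<alpha> \<notin> W" using adm by (auto simp: admissible_def)
    \<comment> \<open>The world grows here: \<open>\<alpha>\<close> moves from the pending
      eigenvariables into scope. The arguments \<open>ys\<close>, which end up below the
      substitution for \<open>\<alpha>\<close>, are safe because their results avoid variables
      outside \<open>W\<close>.\<close>
    have ext: "extends \<theta>' W (eigenvars ?\<rho>) ?\<theta> ?W"
      using env s0 \<alpha> by (auto simp: extends_def env_wf_upd)
    have "admissible \<rho> (\<theta>(\<alpha> := s0)) ?\<theta> ?W"
      using adm reg env s0 by (auto simp: admissible_def env_wf_upd)
    moreover have "realizes c ?\<theta> ?W (eigenvars \<rho>) ?A w (singleton_val s1)"
      using yields_mono[OF uw(5) ext] nf by (intro realizes_singleton_val) (auto simp: arity_def)
    moreover have "realize c ?\<theta> ?W (eigenvars \<rho>) \<Gamma> ys ds"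
      using zs(3) ext by (rule realize_mono) auto
    ultimately have "yields c ?\<theta> ?W (apps (NT \<rho> i) (w # ys)) us"
      using denD[OF us] by (simp del: apps_simps)
    then have "yields c \<theta>' W (ESub (apps (NT \<rho> i) (w # ys)) \<alpha> u) us"
      using uw by (intro yields_ESub) auto
    then have "yields c \<theta>' W (apps (NT ?\<rho> i) (Star u w # ys)) us"
      by (rule yields_production[OF production.Forall[OF der len i]])
    then show "yields c \<theta>' W (apps (NT ?\<rho> i) zs) us"
      unfolding zs(1) by (rule yields_steps[OF steps_first_arg[OF uw(1)]])
  qed
  have prep: "\<exists>d ds s0 s1. ds0 = d # ds \<and> d [] = {s0 # s1} \<and> wf_tm 0 s0 \<and> counter A (singleton_val s1) \<and>
      list_all2 counter \<Gamma> ds" if oks: "list_all2 counter (Forall A # \<Gamma>) ds0" for ds0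
  proof -
    from oks obtain d ds where ds: "ds0 = d # ds" "counter (Forall A) d" "list_all2 counter \<Gamma> ds"
      by (auto simp: list_all2_Cons1)
    obtain s where s: "d [] = {s}" "witness (dual (Forall A)) s"
      using counter_not_fun[OF ds(2)] by auto
    then obtain s0 s1 where "s = s0 # s1" "wf_tm 0 s0" "witness (dual A) s1"
      by (cases s) (auto simp: witness_def)
    then show ?thesis using ds s nf counter_singleton_val by blast
  qed
  show ?thesis
  proof (rule soundI)
    fix \<theta> :: "nat \<Rightarrow> 'a tm" and ds0 :: "'a val list"
    assume env: "env_wf \<theta>" and oks: "list_all2 counter (Forall A # \<Gamma>) ds0"
    from prep[OF oks] obtain d ds s0 s1 where ds: "ds0 = d # ds" "d [] = {s0 # s1}" "wf_tm 0 s0"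
      "counter A (singleton_val s1)" "list_all2 counter \<Gamma> ds" by blast
    let ?\<theta> = "\<theta>(\<alpha> := s0)"
    have "list_all2 counter (?A # \<Gamma>) (singleton_val s1 # ds)" using ds by simp
    note IH' = soundD[OF IH env_wf_upd[OF env ds(3), of \<alpha>] this]
    show "total c ?\<rho> (Forall A # \<Gamma>) \<theta> ds0"
    proof (rule totalI)
      fix i assume i: "i < length (Forall A # \<Gamma>)"
      then have "i < length (?A # \<Gamma>)" by simp
      then obtain us where us: "us \<in> denote c \<rho> (?A # \<Gamma>) ?\<theta> i (singleton_val s1 # ds)"
        "witness ((?A # \<Gamma>) ! i) us" by (rule totalD[OF IH'(1)])
      moreover have "witness ((Forall A # \<Gamma>) ! i) us"
        using us(2) by (cases i) (auto simp: witness_def)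
      ultimately show "\<exists>us\<in>denote c ?\<rho> (Forall A # \<Gamma>) \<theta> i ds0. witness ((Forall A # \<Gamma>) ! i) us"
        using denote[where \<theta> = \<theta> and ?s0.0 = s0 and ?s1.0 = s1 and d = d, OF us(1) ds(2) _ ds(3)] i ds(1) by auto
    qed
    show "winning c ?\<rho> (Forall A # \<Gamma>) \<theta> ds0"
    proof (rule winningI)
      fix v
      obtain i us where i: "i < length (?A # \<Gamma>)" "us \<in> denote c \<rho> (?A # \<Gamma>) ?\<theta> i (singleton_val s1 # ds)"
        "wins v (env_fm ?\<theta> ((?A # \<Gamma>) ! i)) ((singleton_val s1 # ds) ! i) us"
        by (rule winningD[OF IH'(2)])
      have "wins v (env_fm \<theta> ((Forall A # \<Gamma>) ! i)) (ds0 ! i) us"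
      proof (cases i)
        case 0
        have "env_fm ?\<theta> A = env_fm \<theta> A" using fresh(1) by (intro env_fm_cong) auto
        then have "env_fm ?\<theta> ?A = inst 0 s0 (env_fm \<theta> A)"
          using env ds(3) by (simp add: env_fm_inst env_wf_upd)
        then show ?thesis using 0 i(3) ds(1,2) nf by (auto simp: wins_def witness_def)
      next
        case (Suc j)
        then have "env_fm ?\<theta> (\<Gamma> ! j) = env_fm \<theta> (\<Gamma> ! j)" using fresh(2) i(1) by (intro env_fm_cong) auto
        then show ?thesis using Suc i(3) ds(1) by simp
      qed
      then show "\<exists>i<length (Forall A # \<Gamma>). \<exists>us\<in>denote c ?\<rho> (Forall A # \<Gamma>) \<theta> i ds0.
        wins v (env_fm \<theta> ((Forall A # \<Gamma>) ! i)) (ds0 ! i) us"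
        using denote[where \<theta> = \<theta> and ?s0.0 = s0 and ?s1.0 = s1 and d = d, OF i(2) ds(2) _ ds(3)] i(1) ds(1) by (intro exI[of _ i]) auto
    qed
  qed
qed

lemma tau_star_eps: "tau_star (Exists A) = Eps \<longleftrightarrow> n_all A = 0"
  by (auto simp: tau_star_def)

text \<open>The value a premise of an existential inference with witness \<open>r\<close> receives for its principal
  formula. Once all existential quantifiers are instantiated, the counter-witness function returns a
  set of sequences, one of which is selected.\<close>

inductive next_val :: "('f, 'p) fm \<Rightarrow> 'f tm \<Rightarrow> 'f val \<Rightarrow> 'f val \<Rightarrow> bool" for A r d where
  no_fun: "n_all A = 0 \<Longrightarrow> next_val A r d d"
| is_fun: "is_sigma2 A \<Longrightarrow> next_val A r d (\<lambda>s. d (r # s))"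
| select: "n_all A > 0 \<Longrightarrow> \<not> is_sigma2 A \<Longrightarrow> s \<in> d [r] \<Longrightarrow> next_val A r d (singleton_val s)"

lemma next_val_exists:
  assumes "counter (Exists A) d" "wf_tm 0 r" "prenex2 (Exists A)"
  shows "\<exists>d'. next_val A r d d'"
proof (cases "n_all A = 0 \<or> is_sigma2 A")
  case False
  then have "n_ex A = 0" using assms(3) prenex2_Exists_not_fun by blast
  then have "d [r] \<noteq> {}" using okD(1)[OF assms(1), of "[r]"] assms(2) False by (simp add: arity_def)
  then show ?thesis using False next_val.select by blast
qed (auto intro: next_val.intros)

lemma next_val_counter:
  assumes "next_val A r d d'" "counter (Exists A) d" "wf_tm 0 r" "prenex2 (Exists A)"
  shows "counter A d'"
  using assms(1)
proof cases
  case no_fun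
  then have nf: "\<not> is_sigma2 (Exists A)" "\<not> is_sigma2 A" by (auto simp: is_sigma2_def)
  obtain s where "d [] = {s}" "witness (dual (Exists A)) s" by (rule counter_not_fun[OF assms(2) nf(1)])
  then show ?thesis using no_fun nf by (auto simp: counter_def arity_def witness_def)
next
  case is_fun
  then have "is_sigma2 (Exists A)" by (auto simp: is_sigma2_def)
  then have "d (r # s) \<noteq> {} \<and> (\<forall>us\<in>d (r # s). witness (dual (Exists A)) us)"
    if "length s = n_ex A" "\<forall>t\<in>set s. wf_tm 0 t" for s
    using okD[OF assms(2), of "r # s"] assms(3) that by (simp add: arity_def)
  then show ?thesis using is_fun by (auto simp: counter_def arity_def witness_def)
next
  case (select s)
  then have "n_ex A = 0" using assms(4) prenex2_Exists_not_fun by blast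
  then have "witness (dual (Exists A)) s"
    using okD(2)[OF assms(2), of "[r]" s] assms(3) select by (simp add: arity_def)
  then show ?thesis using select counter_singleton_val by (auto simp: witness_def)
qed

lemma next_val_realizes:
  assumes "next_val A (env_tm \<theta> r) d d'" "realizes c \<theta> W E (Exists A) z d" "fv_tm r \<subseteq> W"
    "prenex2 (Exists A)" "env_wf \<theta>"
  shows "realizes c \<theta> W E A (dot (Exists A) z r) d'"
  using assms(1)
proof cases
  case no_fun
  then show ?thesis using assms(2)
    by (simp add: dot_def tau_star_eps realizes_def arity_def is_sigma2_def)
next
  case is_fun
  then have fn: "n_all A > 0" by (simp add: is_sigma2_def)
  show ?thesis unfolding realizes_def
  proof (intro allI impI ballI, goal_cases)
    case (1 \<theta>' W' ts us)
    \<comment> \<open>The function may be called in a later world, but the variables of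
      \<open>r\<close> are already in \<open>W\<close>, so \<open>r\<close> keeps its value.\<close>
    have W: "fv_tm r \<subseteq> W'" "env_tm \<theta>' r = env_tm \<theta> r"
      using assms(3) 1(1) by (auto simp: extends_def intro!: env_tm_cong)
    have "length (Tm r # ts) = arity (Exists A) \<and>
        (\<forall>t\<in>set (Tm r # ts). structured t \<and> fv_tm (eval_tm t) \<subseteq> W')"
      using 1(2) is_fun fn W by (auto simp: arity_def intro: structured.intros)
    moreover have "us \<in> d (map (env_tm \<theta>' \<circ> eval_tm) (Tm r # ts))"
      using 1(3) is_fun W by simp
    ultimately have "yields c \<theta>' W' (apps z (Tm r # ts)) us"
      using realizesD[OF assms(2) 1(1)] by blast
    then show ?case using fn by (simp add: dot_def tau_star_eps)
  qed
next
  case (select s)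
  then have "n_ex A = 0" using assms(4) prenex2_Exists_not_fun by blast
  then have "yields c \<theta> W (apps z [Tm r]) s"
    using select assms(3)
    by (intro realizesD[OF assms(2) extends_refl[OF assms(5)]])
      (auto simp: arity_def intro: structured.intros)
  then show ?thesis using select
    by (auto simp: dot_def tau_star_eps arity_def intro!: realizes_singleton_val)
qed

lemma sound_ExI:
  assumes der: "ExI A r \<rho> \<turnstile> Exists A # \<Gamma>" and wf: "wf_tm 0 r"
    and IH: "sound c \<rho> (inst 0 r A # \<Gamma>)"
    and pnx: "prenex2 (Exists A)" and reg: "regular (ExI A r \<rho>)"
  shows "sound c (ExI A r \<rho>) (Exists A # \<Gamma>)"
proof -
  let ?\<rho> = "ExI A r \<rho>" and ?A = "inst 0 r A"
  note premise_of = premise_of_rules(4)[OF reg]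
  have inst_realizes: "realizes c \<theta> W E ?A z d \<longleftrightarrow> realizes c \<theta> W E A z d" for \<theta> W E z d
    by (simp add: realizes_def)
  have r: "fv_tm r \<subseteq> W" "env_tm \<theta>' r = env_tm \<theta> r" if "admissible ?\<rho> \<theta> \<theta>' W" for \<theta> \<theta>' W
    using that reg by (auto simp: admissible_def intro!: env_tm_cong)
  have denS: "us \<in> denote c ?\<rho> (Exists A # \<Gamma>) \<theta> (Suc i) (d # ds)"
    if us: "us \<in> denote c \<rho> (?A # \<Gamma>) \<theta> (Suc i) (d' # ds)" and d': "next_val A (env_tm \<theta> r) d d'"
      and i: "i < length \<Gamma>" for us \<theta> i d d' ds
  proof (rule denote_premise[OF us premise_of])
    fix \<theta>' W zs
    assume adm: "admissible ?\<rho> \<theta> \<theta>' W"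
      and "realize c \<theta>' W (eigenvars \<rho>) (Exists A # \<Gamma>) zs (d # ds)"
    then obtain z ys where zs: "zs = z # ys" "realizes c \<theta>' W (eigenvars \<rho>) (Exists A) z d"
      "realize c \<theta>' W (eigenvars \<rho>) \<Gamma> ys ds" by (auto simp: realize_Cons)
    then have "realizes c \<theta>' W (eigenvars \<rho>) ?A (dot (Exists A) z r) d'"
      using next_val_realizes[OF _ zs(2) r(1)[OF adm] pnx admissible_env[OF adm]] d' r(2)[OF adm]
      by (simp add: inst_realizes)
    then show "\<exists>zs'. production c (apps (NT ?\<rho> (Suc i)) zs) (apps (NT \<rho> (Suc i)) zs') \<and>
        realize c \<theta>' W (eigenvars \<rho>) (?A # \<Gamma>) zs' (d' # ds)"
      using production.Ex_Suc[OF der, of ys "Suc i" c z] realize_length[OF zs(3)] zs i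
      by (intro exI[of _ "dot (Exists A) z r # ys"]) auto
  qed
  have denote0: "env_tm \<theta> r # us \<in> denote c ?\<rho> (Exists A # \<Gamma>) \<theta> 0 (d # ds)"
    if us: "us \<in> denote c \<rho> (?A # \<Gamma>) \<theta> 0 (d' # ds)" and d': "next_val A (env_tm \<theta> r) d d'"
    for us \<theta> d d' ds
  proof (rule denI)
    fix \<theta>' W zs
    assume adm: "admissible ?\<rho> \<theta> \<theta>' W"
      and "realize c \<theta>' W (eigenvars ?\<rho>) (Exists A # \<Gamma>) zs (d # ds)"
    then obtain z ys where zs: "zs = z # ys" "realizes c \<theta>' W (eigenvars \<rho>) (Exists A) z d"
      "realize c \<theta>' W (eigenvars \<rho>) \<Gamma> ys ds" by (auto simp: realize_Cons)
    have "realizes c \<theta>' W (eigenvars \<rho>) ?A (dot (Exists A) z r) d'"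
      using next_val_realizes[OF _ zs(2) r(1)[OF adm] pnx admissible_env[OF adm]] d' r(2)[OF adm]
      by (simp add: inst_realizes)
    then have "yields c \<theta>' W (apps (NT \<rho> 0) (dot (Exists A) z r # ys)) us"
      using denD[OF us premise_of_admissible[OF premise_of adm]] zs by (simp del: apps_simps)
    then have "yields c \<theta>' W (Star (Tm r) (apps (NT \<rho> 0) (dot (Exists A) z r # ys)))
        (env_tm \<theta>' (eval_tm (Tm r :: ('a, 'b) gtm)) # us)"
      using r(1)[OF adm] by (intro yields_Star) (auto intro: structured.intros)
    then have "yields c \<theta>' W (Star (Tm r) (apps (NT \<rho> 0) (dot (Exists A) z r # ys))) (env_tm \<theta> r # us)"
      using r(2)[OF adm] by (simp del: apps_simps)
    moreover have "length ys = length \<Gamma>" using realize_length[OF zs(3)] by simp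
    ultimately show "yields c \<theta>' W (apps (NT ?\<rho> 0) zs) (env_tm \<theta> r # us)"
      unfolding zs(1) by (intro yields_production[OF production.Ex_0[OF der]])
  qed
  show ?thesis
  proof (rule soundI)
    fix \<theta> :: "nat \<Rightarrow> 'a tm" and ds0 :: "'a val list"
    assume env: "env_wf \<theta>" and "list_all2 counter (Exists A # \<Gamma>) ds0"
    then obtain d ds where ds: "ds0 = d # ds" "counter (Exists A) d" "list_all2 counter \<Gamma> ds"
      by (auto simp: list_all2_Cons1)
    let ?r = "env_tm \<theta> r"
    have wfr: "wf_tm 0 ?r" using wf_env_tm env wf by blast
    have IH': "total c \<rho> (?A # \<Gamma>) \<theta> (d' # ds)" "winning c \<rho> (?A # \<Gamma>) \<theta> (d' # ds)"
      if "next_val A ?r d d'" for d'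
      using soundD[OF IH env, of "d' # ds"] ds next_val_counter[OF that ds(2) wfr pnx] by auto
    obtain d' where d': "next_val A ?r d d'" using next_val_exists[OF ds(2) wfr pnx] by blast
    show "total c ?\<rho> (Exists A # \<Gamma>) \<theta> ds0"
    proof (rule totalI)
      fix i assume i: "i < length (Exists A # \<Gamma>)"
      then have "i < length (?A # \<Gamma>)" by simp
      then obtain us where us: "us \<in> denote c \<rho> (?A # \<Gamma>) \<theta> i (d' # ds)" "witness ((?A # \<Gamma>) ! i) us"
        by (rule totalD[OF IH'(1)[OF d']])
      show "\<exists>us\<in>denote c ?\<rho> (Exists A # \<Gamma>) \<theta> i ds0. witness ((Exists A # \<Gamma>) ! i) us"
      proof (cases i)
        case 0
        then show ?thesis using us denote0[OF _ d'] ds(1) wfr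
          by (intro bexI[of _ "?r # us"]) (auto simp: witness_Cons)
      next
        case (Suc j)
        then show ?thesis using us denS[OF _ d'] ds(1) i by (intro bexI[of _ us]) auto
      qed
    qed
    show "winning c ?\<rho> (Exists A # \<Gamma>) \<theta> ds0"
    proof (rule winningI)
      fix v
      let ?goal = "\<exists>i<length (Exists A # \<Gamma>). \<exists>us\<in>denote c ?\<rho> (Exists A # \<Gamma>) \<theta> i ds0.
        wins v (env_fm \<theta> ((Exists A # \<Gamma>) ! i)) (ds0 ! i) us"
      \<comment> \<open>One run of the premise against \<open>d'\<close>: either a side formula
        wins, which settles the goal, or the principal formula does.\<close>
      have cases: "?goal \<or> (\<exists>us\<in>denote c \<rho> (?A # \<Gamma>) \<theta> 0 (d' # ds). wins v (env_fm \<theta> ?A) d' us)"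
        if d': "next_val A ?r d d'" for d'
      proof -
        obtain i us where i: "i < length (?A # \<Gamma>)" "us \<in> denote c \<rho> (?A # \<Gamma>) \<theta> i (d' # ds)"
          "wins v (env_fm \<theta> ((?A # \<Gamma>) ! i)) ((d' # ds) ! i) us"
          by (rule winningD[OF IH'(2)[OF d']])
        show ?thesis
        proof (cases i)
          case 0
          then show ?thesis using i by auto
        next
          case (Suc j)
          then have "us \<in> denote c ?\<rho> (Exists A # \<Gamma>) \<theta> i ds0" using i denS[OF _ d'] ds(1) by auto
          moreover have "wins v (env_fm \<theta> ((Exists A # \<Gamma>) ! i)) (ds0 ! i) us" using Suc i ds(1) by simp
          moreover have "i < length (Exists A # \<Gamma>)" using i by simp
          ultimately show ?thesis by blast
        qed
      qed
      have principal: ?goal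
        if "us \<in> denote c ?\<rho> (Exists A # \<Gamma>) \<theta> 0 ds0" "wins v (env_fm \<theta> (Exists A)) d us" for us
        using that ds(1) by (intro exI[of _ 0]) auto
      have sbfA: "env_fm \<theta> ?A = inst 0 ?r (env_fm \<theta> A)" using env by (simp add: env_fm_inst)
      show ?goal
      proof (cases "n_all A > 0 \<and> \<not> is_sigma2 A")
        case False
        obtain d' where d': "next_val A ?r d d'" "n_all A = 0 \<and> d' = d \<or> is_sigma2 A \<and> d' = (\<lambda>s. d (?r # s))"
        proof (cases "n_all A = 0")
          case True
          then show ?thesis using that[OF next_val.no_fun] by simp
        next
          case f: False
          then show ?thesis using that[OF next_val.is_fun] False by simp
        qed
        from cases[OF d'(1)] show ?thesis
        proof
          assume "\<exists>us\<in>denote c \<rho> (?A # \<Gamma>) \<theta> 0 (d' # ds). wins v (env_fm \<theta> ?A) d' us"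
          then obtain us where us: "us \<in> denote c \<rho> (?A # \<Gamma>) \<theta> 0 (d' # ds)" "wins v (env_fm \<theta> ?A) d' us"
            by blast
          \<comment> \<open>Without universal quantifiers the counter-witness is the empty sequence,
            so \<open>?r\<close> is the first term to instantiate the formula.\<close>
          have "d [] = {[]}" if "n_all A = 0"
            using counter_not_fun[OF ds(2)] that by (auto simp: witness_def)
          moreover have "witness A us" using wins_witness[OF us(2)] by simp
          moreover have "is_sigma2 A \<longrightarrow> n_all A \<noteq> 0" by (simp add: is_sigma2_def)
          ultimately have "wins v (env_fm \<theta> (Exists A)) d (?r # us)"
            using us(2) d'(2) wfr unfolding sbfA wins_def by (elim disjE conjE) (simp_all add: witness_Cons)
          then show ?thesis using principal denote0[OF us(1) d'(1)] ds(1) by blast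
        qed
      next
        case True
        then have ex: "n_ex A = 0" using pnx prenex2_Exists_not_fun by blast
        show ?thesis
        \<comment> \<open>At the last existential quantifier of the block the premise is run once
          for every answer \<open>s\<close> in \<open>d [?r]\<close>. If no side formula ever wins,
          each answer is beaten at the principal formula, so \<open>[?r]\<close> beats them
          all.\<close>
        proof (rule ccontr)
          assume no: "\<not> ?goal"
          have all: "[] \<in> denote c \<rho> (?A # \<Gamma>) \<theta> 0 (singleton_val s # ds) \<and> wins v (env_fm \<theta> ?A) (singleton_val s) []"
            if "s \<in> d [?r]" for s
          proof -
            have "next_val A ?r d (singleton_val s)" using True that next_val.select by blast
            from cases[OF this] no obtain us where us:
              "us \<in> denote c \<rho> (?A # \<Gamma>) \<theta> 0 (singleton_val s # ds)" "wins v (env_fm \<theta> ?A) (singleton_val s) us" by blast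
            moreover have "us = []" using wins_witness[OF us(2)] ex by (simp add: witness_def)
            ultimately show ?thesis by simp
          qed
          have "wins v (env_fm \<theta> (Exists A)) d [?r]"
            using all True ex wfr unfolding sbfA wins_def by (auto simp: witness_def)
          \<comment> \<open>Beating all answers is not yet a derivation; since \<open>d [?r]\<close>
            is not empty, some run of the premise supplies one.\<close>
          moreover obtain s where "next_val A ?r d (singleton_val s)" "s \<in> d [?r]"
            using d' True by cases (auto intro: next_val.intros)
          ultimately show False using no principal denote0 all ds(1) by blast
        qed
      qed
    qed
  qed
qed

section \<open>Structural rules\<close>

lemma sound_Contr:
  assumes der: "\<rho> \<turnstile> A # A # \<Gamma>" and IH: "sound c \<rho> (A # A # \<Gamma>)"
  shows "sound c (Contr \<rho>) (A # \<Gamma>)"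
proof -
  \<comment> \<open>Both copies get the same counter-witness, so an answer for either serves the
    contracted formula. Truncated subtraction in \<open>j - 1\<close> sends 0 and 1 to 0, matching
    the two productions for the principal formula.\<close>
  have denote: "us \<in> denote c (Contr \<rho>) (A # \<Gamma>) \<theta> i (d # ds)"
    if us: "us \<in> denote c \<rho> (A # A # \<Gamma>) \<theta> j (d # d # ds)"
      and ij: "i \<le> length \<Gamma>" "i = j - 1"
    for us \<theta> i j d ds
  proof (rule denote_premise[OF us premise_of_rules(2)])
    fix \<theta>' W zs
    assume "realize c \<theta>' W (eigenvars \<rho>) (A # \<Gamma>) zs (d # ds)"
    then obtain z ys where zs: "zs = z # ys" "realizes c \<theta>' W (eigenvars \<rho>) A z d"
      "realize c \<theta>' W (eigenvars \<rho>) \<Gamma> ys ds" by (auto simp: realize_Cons)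
    have len: "length ys = length \<Gamma>" using realize_length[OF zs(3)] by simp
    have "production c (apps (NT (Contr \<rho>) i) (z # ys)) (apps (NT \<rho> j) (z # z # ys))"
    proof (cases "i = 0")
      case True
      then have "j \<in> {0, 1}" using ij by auto
      then show ?thesis unfolding True by (rule production.Contr_0[OF der len])
    next
      case False
      then show ?thesis using production.Contr_Suc[OF der len, of i c z] ij by (simp del: apps_simps)
    qed
    then show "\<exists>zs'. production c (apps (NT (Contr \<rho>) i) zs) (apps (NT \<rho> j) zs') \<and>
        realize c \<theta>' W (eigenvars \<rho>) (A # A # \<Gamma>) zs' (d # d # ds)"
      using zs by (intro exI[of _ "z # z # ys"]) (auto simp del: apps_simps)
  qed
  have nth: "(x # xs) ! (j - 1) = (x # x # xs) ! j" for x :: 'x and xs j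
    by (cases j) auto
  show ?thesis
  proof (rule soundI)
    fix \<theta> :: "nat \<Rightarrow> 'a tm" and ds0 :: "'a val list"
    assume env: "env_wf \<theta>" and "list_all2 counter (A # \<Gamma>) ds0"
    then obtain d ds where ds: "ds0 = d # ds" "counter A d" "list_all2 counter \<Gamma> ds"
      by (auto simp: list_all2_Cons1)
    have "list_all2 counter (A # A # \<Gamma>) (d # d # ds)" using ds by simp
    note IH' = soundD[OF IH env this]
    show "total c (Contr \<rho>) (A # \<Gamma>) \<theta> ds0"
    proof (rule totalI)
      fix i assume i: "i < length (A # \<Gamma>)"
      then have "Suc i < length (A # A # \<Gamma>)" by simp
      then obtain us where us: "us \<in> denote c \<rho> (A # A # \<Gamma>) \<theta> (Suc i) (d # d # ds)"
        "witness ((A # A # \<Gamma>) ! Suc i) us" by (rule totalD[OF IH'(1)])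
      then show "\<exists>us\<in>denote c (Contr \<rho>) (A # \<Gamma>) \<theta> i ds0. witness ((A # \<Gamma>) ! i) us"
        using denote[OF us(1), of i] i ds(1) by auto
    qed
    show "winning c (Contr \<rho>) (A # \<Gamma>) \<theta> ds0"
    proof (rule winningI)
      fix v
      obtain j us where j: "j < length (A # A # \<Gamma>)" "us \<in> denote c \<rho> (A # A # \<Gamma>) \<theta> j (d # d # ds)"
        "wins v (env_fm \<theta> ((A # A # \<Gamma>) ! j)) ((d # d # ds) ! j) us"
        by (rule winningD[OF IH'(2)])
      have "wins v (env_fm \<theta> ((A # \<Gamma>) ! (j - 1))) (ds0 ! (j - 1)) us"
        using j(3) ds(1) by (simp only: nth)
      moreover have "us \<in> denote c (Contr \<rho>) (A # \<Gamma>) \<theta> (j - 1) ds0"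
        using denote[OF j(2), of "j - 1"] j(1) ds(1) by auto
      moreover have "j - 1 < length (A # \<Gamma>)" using j(1) by auto
      ultimately show "\<exists>i<length (A # \<Gamma>). \<exists>us\<in>denote c (Contr \<rho>) (A # \<Gamma>) \<theta> i ds0.
        wins v (env_fm \<theta> ((A # \<Gamma>) ! i)) (ds0 ! i) us" by blast
    qed
  qed
qed

text \<open>The padding with the constant \<open>c\<close> is never shown to win; it only gives the
  new formula a result, as totality demands. The winner always comes from the premise.\<close>

lemma sound_Weak:
  assumes der: "\<rho> \<turnstile> \<Gamma>" and IH: "sound c \<rho> \<Gamma>" and reg: "regular (Weak A \<rho>)"
  shows "sound c (Weak A \<rho>) (A # \<Gamma>)"
proof -
  let ?us = "replicate (n_ex A) (Fn c [])"
  have denote0: "?us \<in> denote c (Weak A \<rho>) (A # \<Gamma>) \<theta> 0 (d # ds)" for \<theta> d ds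
  proof (rule denI)
    fix \<theta>' W zs
    assume "realize c \<theta>' W (eigenvars (Weak A \<rho>)) (A # \<Gamma>) zs (d # ds)"
    then obtain z ys where zs: "zs = z # ys"
      "realize c \<theta>' W (eigenvars (Weak A \<rho>)) \<Gamma> ys ds" by (auto simp: realize_Cons)
    have len: "length ys = length \<Gamma>" using realize_length[OF zs(2)] by simp
    have "yields c \<theta>' W (tuple (replicate (n_ex A) (Tm (Fn c []) :: ('a, 'b) gtm)))
        (map (env_tm \<theta>' \<circ> eval_tm) (replicate (n_ex A) (Tm (Fn c []) :: ('a, 'b) gtm)))"
      by (rule yields_tuple) (auto intro: structured.intros)
    then have "yields c \<theta>' W (tuple (replicate (n_ex A) (Tm (Fn c []) :: ('a, 'b) gtm))) ?us"
      by simp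
    then show "yields c \<theta>' W (apps (NT (Weak A \<rho>) 0) zs) ?us"
      unfolding zs(1) by (rule yields_production[OF production.Weak_0[OF der len]])
  qed
  have denS: "us \<in> denote c (Weak A \<rho>) (A # \<Gamma>) \<theta> (Suc i) (d # ds)"
    if us: "us \<in> denote c \<rho> \<Gamma> \<theta> i ds" and i: "i < length \<Gamma>" for us \<theta> i d ds
  proof (rule denote_premise[OF us premise_of_rules(5)[OF reg]])
    fix \<theta>' W zs
    assume "realize c \<theta>' W (eigenvars \<rho>) (A # \<Gamma>) zs (d # ds)"
    then obtain z ys where zs: "zs = z # ys" "realize c \<theta>' W (eigenvars \<rho>) \<Gamma> ys ds"
      by (auto simp: realize_Cons)
    have len: "length ys = length \<Gamma>" using realize_length[OF zs(2)] by simp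
    show "\<exists>zs'. production c (apps (NT (Weak A \<rho>) (Suc i)) zs) (apps (NT \<rho> i) zs') \<and>
        realize c \<theta>' W (eigenvars \<rho>) \<Gamma> zs' ds"
      using zs production.Weak_Suc[OF der len, of "Suc i" c A z] i
      by (intro exI[of _ ys]) (auto simp del: apps_simps)
  qed
  show ?thesis
  proof (rule soundI)
    fix \<theta> :: "nat \<Rightarrow> 'a tm" and ds0 :: "'a val list"
    assume env: "env_wf \<theta>" and "list_all2 counter (A # \<Gamma>) ds0"
    then obtain d ds where ds: "ds0 = d # ds" "list_all2 counter \<Gamma> ds"
      by (auto simp: list_all2_Cons1)
    note IH' = soundD[OF IH env ds(2)]
    show "total c (Weak A \<rho>) (A # \<Gamma>) \<theta> ds0"
    proof (rule totalI)
      fix i assume i: "i < length (A # \<Gamma>)"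
      show "\<exists>us\<in>denote c (Weak A \<rho>) (A # \<Gamma>) \<theta> i ds0. witness ((A # \<Gamma>) ! i) us"
      proof (cases i)
        case 0
        then show ?thesis using denote0 ds(1) by (intro bexI[of _ ?us]) (auto simp: witness_def)
      next
        case (Suc j)
        then have j: "j < length \<Gamma>" using i by simp
        obtain us where "us \<in> denote c \<rho> \<Gamma> \<theta> j ds" "witness (\<Gamma> ! j) us" using j by (rule totalD[OF IH'(1)])
        then show ?thesis using denS j ds(1) Suc by auto
      qed
    qed
    show "winning c (Weak A \<rho>) (A # \<Gamma>) \<theta> ds0"
    proof (rule winningI)
      fix v
      obtain j us where j: "j < length \<Gamma>" "us \<in> denote c \<rho> \<Gamma> \<theta> j ds"
        "wins v (env_fm \<theta> (\<Gamma> ! j)) (ds ! j) us"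
        by (rule winningD[OF IH'(2)])
      then show "\<exists>i<length (A # \<Gamma>). \<exists>us\<in>denote c (Weak A \<rho>) (A # \<Gamma>) \<theta> i ds0.
        wins v (env_fm \<theta> ((A # \<Gamma>) ! i)) (ds0 ! i) us"
        using denS[OF j(2,1)] ds(1) by (intro exI[of _ "Suc j"]) auto
    qed
  qed
qed

lemma sound_Perm:
  assumes der: "\<rho> \<turnstile> \<Gamma> @ B # A # \<Delta>" and IH: "sound c \<rho> (\<Gamma> @ B # A # \<Delta>)"
  shows "sound c (Perm (length \<Gamma>) \<rho>) (\<Gamma> @ A # B # \<Delta>)"
proof -
  let ?k = "length \<Gamma>" and ?\<Gamma> = "\<Gamma> @ A # B # \<Delta>" and ?\<Gamma>' = "\<Gamma> @ B # A # \<Delta>"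
  define swap where "swap i = (if i = ?k then ?k + 1 else if i = ?k + 1 then ?k else i)" for i
  have swap_swap: "swap (swap i) = i" for i by (auto simp: swap_def)
  have nth: "(xs @ y # x # ys) ! swap i = (xs @ x # y # ys) ! i" if "length xs = ?k"
    for xs ys i and x y :: 'x
    using that by (auto simp: swap_def nth_append nth_Cons' )
  have swap_less: "swap i < length ?\<Gamma>'" if "i < length ?\<Gamma>" for i
    using that by (auto simp: swap_def)
  have denote: "us \<in> denote c (Perm ?k \<rho>) ?\<Gamma> \<theta> i (xs @ d0 # d1 # ys)"
    if us: "us \<in> denote c \<rho> ?\<Gamma>' \<theta> (swap i) (xs @ d1 # d0 # ys)" and len: "length xs = ?k"
      and i: "i < length ?\<Gamma>" for us \<theta> i xs d0 d1 ys
  proof (rule denote_premise[OF us premise_of_rules(3)])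
    fix \<theta>' W zs
    assume rl: "realize c \<theta>' W (eigenvars \<rho>) ?\<Gamma> zs (xs @ d0 # d1 # ys)"
    obtain zx zs' where zx: "zs = zx @ zs'" "realize c \<theta>' W (eigenvars \<rho>) \<Gamma> zx xs"
      "realize c \<theta>' W (eigenvars \<rho>) (A # B # \<Delta>) zs' (d0 # d1 # ys)"
      using rl len by (auto simp: realize_append)
    obtain z0 z1 zy where zy: "zs' = z0 # z1 # zy" "realizes c \<theta>' W (eigenvars \<rho>) A z0 d0"
      "realizes c \<theta>' W (eigenvars \<rho>) B z1 d1" "realize c \<theta>' W (eigenvars \<rho>) \<Delta> zy ys"
      using zx(3) by (auto simp: realize_Cons)
    have "production c (apps (NT (Perm ?k \<rho>) i) (zx @ z0 # z1 # zy))
        (apps (NT \<rho> (swap i)) (zx @ z1 # z0 # zy))"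
      using realize_length[OF zx(2)] realize_length[OF zy(4)] i
      by (intro production.Perm[OF der]) (auto simp: swap_def)
    moreover have "realize c \<theta>' W (eigenvars \<rho>) ?\<Gamma>' (zx @ z1 # z0 # zy) (xs @ d1 # d0 # ys)"
      using realize_append[OF len] zx(2) zy
      by (metis realize.simps(2))
    ultimately show "\<exists>zs'. production c (apps (NT (Perm ?k \<rho>) i) zs) (apps (NT \<rho> (swap i)) zs') \<and>
        realize c \<theta>' W (eigenvars \<rho>) ?\<Gamma>' zs' (xs @ d1 # d0 # ys)"
      using zx(1) zy(1) by blast
  qed
  show ?thesis
  proof (rule soundI)
    fix \<theta> :: "nat \<Rightarrow> 'a tm" and ds0 :: "'a val list"
    assume env: "env_wf \<theta>" and oks: "list_all2 counter ?\<Gamma> ds0"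
    obtain xs ds1 where xs: "ds0 = xs @ ds1" "list_all2 counter \<Gamma> xs" "list_all2 counter (A # B # \<Delta>) ds1"
      using oks by (auto simp: list_all2_append1)
    obtain d0 d1 ys where ds: "ds1 = d0 # d1 # ys" "counter A d0" "counter B d1" "list_all2 counter \<Delta> ys"
      using xs(3) by (auto simp: list_all2_Cons1)
    have len: "length xs = ?k" using list_all2_lengthD[OF xs(2)] by simp
    have "list_all2 counter ?\<Gamma>' (xs @ d1 # d0 # ys)"
      using xs ds by (intro list_all2_appendI) auto
    note IH' = soundD[OF IH env this]
    have ds0: "ds0 = xs @ d0 # d1 # ys" using xs(1) ds(1) by simp
    show "total c (Perm ?k \<rho>) ?\<Gamma> \<theta> ds0"
    proof (rule totalI)
      fix i assume i: "i < length ?\<Gamma>"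
      obtain us where us: "us \<in> denote c \<rho> ?\<Gamma>' \<theta> (swap i) (xs @ d1 # d0 # ys)" "witness (?\<Gamma>' ! swap i) us"
        by (rule totalD[OF IH'(1) swap_less[OF i]])
      have "witness (?\<Gamma> ! i) us" using us(2) by (simp only: nth)
      with denote[OF us(1) len i] show "\<exists>us\<in>denote c (Perm ?k \<rho>) ?\<Gamma> \<theta> i ds0. witness (?\<Gamma> ! i) us"
        unfolding ds0 by blast
    qed
    show "winning c (Perm ?k \<rho>) ?\<Gamma> \<theta> ds0"
    proof (rule winningI)
      fix v
      obtain j us where j: "j < length ?\<Gamma>'" "us \<in> denote c \<rho> ?\<Gamma>' \<theta> j (xs @ d1 # d0 # ys)"
        "wins v (env_fm \<theta> (?\<Gamma>' ! j)) ((xs @ d1 # d0 # ys) ! j) us"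
        by (rule winningD[OF IH'(2)])
      have i: "swap j < length ?\<Gamma>" using j(1) swap_less[of j] by simp
      have "us \<in> denote c (Perm ?k \<rho>) ?\<Gamma> \<theta> (swap j) ds0"
        unfolding ds0 using j(2) len i by (intro denote) (simp_all only: swap_swap)
      moreover have "wins v (env_fm \<theta> (?\<Gamma> ! swap j)) (ds0 ! swap j) us"
        unfolding ds0 using j(3) len by (simp only: nth)
      ultimately show "\<exists>i<length ?\<Gamma>. \<exists>us\<in>denote c (Perm ?k \<rho>) ?\<Gamma> \<theta> i ds0.
        wins v (env_fm \<theta> (?\<Gamma> ! i)) (ds0 ! i) us" using i by blast
    qed
  qed
qed

text \<open>In a cut, \<open>F\<close> denotes the cut formula that does not begin with an existential quantifier,
  proved by \<open>\<rho>\<^sub>0\<close>; the other premise \<open>\<rho>\<^sub>1\<close> proves \<open>dual F\<close> and receives the value \<open>cut_val\<close>.\<close>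

definition cut_val :: "'f \<Rightarrow> ('f, 'p) fm \<Rightarrow> ('f, 'p) lkproof \<Rightarrow> ('f, 'p) fm list \<Rightarrow>
    (nat \<Rightarrow> 'f tm) \<Rightarrow> 'f val list \<Rightarrow> 'f val" where
  "cut_val c F \<rho>\<^sub>0 \<Gamma> \<theta> xs =
    (if n_ex F = 0 then singleton_val []
     else (\<lambda>s. {us \<in> denote c \<rho>\<^sub>0 (F # \<Gamma>) \<theta> 0 (singleton_val s # xs). witness F us}))"

definition not_ex :: "('f, 'p) fm \<Rightarrow> bool" where
  "not_ex F \<longleftrightarrow> prenex2 F \<and> (\<forall>A. F \<noteq> Exists A)"

lemma not_ex_cases:
  assumes "not_ex F"
  obtains A where "F = Forall A" "prenex2 (Forall A)" | "qfree F"
  using assms by (cases F) (auto simp: not_ex_def dest: prenex2_And prenex2_Or)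

lemma not_ex_is_sigma2: "not_ex F \<Longrightarrow> \<not> is_sigma2 F"
  by (auto simp: not_ex_def is_sigma2_def)

lemma not_ex_is_sigma2_dual: "not_ex F \<Longrightarrow> is_sigma2 (dual F) \<longleftrightarrow> n_ex F > 0"
  by (erule not_ex_cases) (auto simp: is_sigma2_qfree dest: qfree_counts)

text \<open>Non-emptiness of the answers at \<open>s\<close> is totality of the first premise at
  \<open>F\<close>, run against the counter-witness \<open>s\<close>.\<close>

lemma cut_val_counter:
  assumes "sound c \<rho>\<^sub>0 (F # \<Gamma>)" "not_ex F" "env_wf \<theta>" "list_all2 counter \<Gamma> xs"
  shows "counter (dual F) (cut_val c F \<rho>\<^sub>0 \<Gamma> \<theta> xs)"
proof (cases "n_ex F = 0")
  case True
  then show ?thesis using not_ex_is_sigma2_dual[OF assms(2)]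
    by (auto simp: cut_val_def witness_def intro!: counter_singleton_val)
next
  case False
  have ne: "cut_val c F \<rho>\<^sub>0 \<Gamma> \<theta> xs s \<noteq> {}" if "witness (dual F) s" for s
  proof -
    have "list_all2 counter (F # \<Gamma>) (singleton_val s # xs)"
      using counter_singleton_val[OF not_ex_is_sigma2[OF assms(2)] that] assms(4) by simp
    from totalD[OF soundD(1)[OF assms(1,3) this], of 0] show ?thesis
      using False by (auto simp: cut_val_def)
  qed
  have "witness F us" if "us \<in> cut_val c F \<rho>\<^sub>0 \<Gamma> \<theta> xs s" for us s
    using that False by (simp add: cut_val_def)
  then show ?thesis using not_ex_is_sigma2_dual[OF assms(2)] False ne
    unfolding counter_def by (auto simp: arity_def witness_def[of "dual F"])
qed

text \<open>The part of the cut that mentions no terms of the grammar, isolated so that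
  \<open>sound_Cut\<close> can use it with the premises in either order. \<open>D0\<close> collects
  the sequences derived for \<open>dual F\<close>, each of which can serve as counter-witness for
  \<open>F\<close>.\<close>

lemma cut_semantics:
  assumes IH: "sound c \<rho>\<^sub>0 (F # \<Gamma>)" "sound c \<rho>\<^sub>1 (dual F # \<Delta>)"
    and F: "not_ex F" and env: "env_wf \<theta>" and oks: "list_all2 counter \<Gamma> xs" "list_all2 counter \<Delta> ys"
    and D0: "D0 = {s \<in> denote c \<rho>\<^sub>1 (dual F # \<Delta>) \<theta> 0 (cut_val c F \<rho>\<^sub>0 \<Gamma> \<theta> xs # ys). witness (dual F) s}"
  shows "i < length \<Gamma> \<Longrightarrow> \<exists>s\<in>D0. \<exists>us\<in>denote c \<rho>\<^sub>0 (F # \<Gamma>) \<theta> (Suc i) (singleton_val s # xs). witness (\<Gamma> ! i) us"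
    and "i < length \<Delta> \<Longrightarrow>
      \<exists>us\<in>denote c \<rho>\<^sub>1 (dual F # \<Delta>) \<theta> (Suc i) (cut_val c F \<rho>\<^sub>0 \<Gamma> \<theta> xs # ys). witness (\<Delta> ! i) us"
    and "(\<exists>i<length \<Gamma>. \<exists>s\<in>D0. \<exists>us\<in>denote c \<rho>\<^sub>0 (F # \<Gamma>) \<theta> (Suc i) (singleton_val s # xs).
          wins v (env_fm \<theta> (\<Gamma> ! i)) (xs ! i) us) \<or>
      (\<exists>i<length \<Delta>. \<exists>us\<in>denote c \<rho>\<^sub>1 (dual F # \<Delta>) \<theta> (Suc i) (cut_val c F \<rho>\<^sub>0 \<Gamma> \<theta> xs # ys).
          wins v (env_fm \<theta> (\<Delta> ! i)) (ys ! i) us)"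
proof -
  let ?d = "cut_val c F \<rho>\<^sub>0 \<Gamma> \<theta> xs"
  have "list_all2 counter (dual F # \<Delta>) (?d # ys)"
    using cut_val_counter[OF IH(1) F env oks(1)] oks(2) by simp
  note IH1 = soundD[OF IH(2) env this]
  have IH0: "total c \<rho>\<^sub>0 (F # \<Gamma>) \<theta> (singleton_val s # xs)" "winning c \<rho>\<^sub>0 (F # \<Gamma>) \<theta> (singleton_val s # xs)"
    if "s \<in> D0" for s
    using soundD[OF IH(1) env, of "singleton_val s # xs"] oks(1) that
      counter_singleton_val[OF not_ex_is_sigma2[OF F], of s] by (auto simp: D0)
  show "\<exists>us\<in>denote c \<rho>\<^sub>1 (dual F # \<Delta>) \<theta> (Suc i) (?d # ys). witness (\<Delta> ! i) us" if "i < length \<Delta>"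
    using totalD[OF IH1(1), of "Suc i"] that by auto
  show "\<exists>s\<in>D0. \<exists>us\<in>denote c \<rho>\<^sub>0 (F # \<Gamma>) \<theta> (Suc i) (singleton_val s # xs). witness (\<Gamma> ! i) us"
    if i: "i < length \<Gamma>"
  proof -
    \<comment> \<open>\<open>D0\<close> is not empty, by totality of the other premise at
      \<open>dual F\<close>.\<close>
    obtain s where s: "s \<in> D0" using totalD[OF IH1(1), of 0] by (auto simp: D0)
    obtain us where "us \<in> denote c \<rho>\<^sub>0 (F # \<Gamma>) \<theta> (Suc i) (singleton_val s # xs)" "witness (\<Gamma> ! i) us"
      using totalD[OF IH0(1)[OF s], of "Suc i"] i by auto
    then show ?thesis using s by blast
  qed
  show "(\<exists>i<length \<Gamma>. \<exists>s\<in>D0. \<exists>us\<in>denote c \<rho>\<^sub>0 (F # \<Gamma>) \<theta> (Suc i) (singleton_val s # xs).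
        wins v (env_fm \<theta> (\<Gamma> ! i)) (xs ! i) us) \<or>
    (\<exists>i<length \<Delta>. \<exists>us\<in>denote c \<rho>\<^sub>1 (dual F # \<Delta>) \<theta> (Suc i) (?d # ys).
        wins v (env_fm \<theta> (\<Delta> ! i)) (ys ! i) us)" (is "?L \<or> ?R")
  proof (rule ccontr)
    assume no: "\<not> (?L \<or> ?R)"
    obtain j s where j: "j < length (dual F # \<Delta>)" "s \<in> denote c \<rho>\<^sub>1 (dual F # \<Delta>) \<theta> j (?d # ys)"
      "wins v (env_fm \<theta> ((dual F # \<Delta>) ! j)) ((?d # ys) ! j) s"
      by (rule winningD[OF IH1(2)])
    have "j = 0"
    proof (cases j)
      case (Suc i)
      then have ?R using j by auto
      then show ?thesis using no by blast
    qed
    then have s: "s \<in> denote c \<rho>\<^sub>1 (dual F # \<Delta>) \<theta> 0 (?d # ys)" "wins v (env_fm \<theta> (dual F)) ?d s"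
      using j by auto
    then have witness_s: "witness (dual F) s" using wins_witness[OF s(2)] by simp
    then have "s \<in> D0" using s by (simp add: D0)
    obtain k us where k: "k < length (F # \<Gamma>)" "us \<in> denote c \<rho>\<^sub>0 (F # \<Gamma>) \<theta> k (singleton_val s # xs)"
      "wins v (env_fm \<theta> ((F # \<Gamma>) ! k)) ((singleton_val s # xs) ! k) us"
      by (rule winningD[OF IH0(2)[OF \<open>s \<in> D0\<close>]])
    have "k = 0"
    proof (cases k)
      case (Suc i)
      then have ?L using k \<open>s \<in> D0\<close> by auto
      then show ?thesis using no by blast
    qed
    then have us: "us \<in> denote c \<rho>\<^sub>0 (F # \<Gamma>) \<theta> 0 (singleton_val s # xs)" "wins v (env_fm \<theta> F) (singleton_val s) us"
      using k by auto
    have witness_us: "witness F us" using wins_witness[OF us(2)] by simp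
    have pos: "holds v (full_inst (env_fm \<theta> F) (s @ us))"
      using us(2) not_ex_is_sigma2[OF F] by (simp add: wins_def)
    \<comment> \<open>The sequence \<open>s\<close> wins for \<open>dual F\<close> against every
      answer of \<open>?d\<close>, and \<open>us\<close> is one of them by the definition of
      \<open>cut_val\<close>. So the same list makes both \<open>F\<close> and its dual
      true.\<close>
    have neg: "holds v (full_inst (dual (env_fm \<theta> F)) (s @ us))"
    proof (cases "n_ex F = 0")
      case True
      then have "us = []" using witness_us by (simp add: witness_def)
      then show ?thesis using s(2) True not_ex_is_sigma2_dual[OF F]
        by (auto simp: wins_def cut_val_def env_fm_dual[symmetric])
    next
      case False
      then have "us \<in> ?d s" using us(1) witness_us by (simp add: cut_val_def)
      then show ?thesis using s(2) False not_ex_is_sigma2_dual[OF F]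
        by (auto simp: wins_def env_fm_dual[symmetric])
    qed
    have "prenex2 (env_fm \<theta> F)"
      using F by (auto simp: not_ex_def intro: prenex2_env_fm)
    then have "qfree (full_inst (env_fm \<theta> F) (s @ us))"
      using witness_s witness_us by (intro prenex2_full_inst) (auto simp: witness_def)
    with pos neg show False by (simp add: full_inst_dual holds_dual)
  qed
qed

lemma tau_eps: "tau F = Eps \<longleftrightarrow> n_ex F = 0"
  by (cases "n_ex F") (auto simp: tau_def opow_def)

text \<open>A call beta-reduces to the non-terminal of \<open>\<rho>\<^sub>0\<close> on a tuple, and
  \<open>denote\<close> promises the result in every admissible world. The arguments
  \<open>zx\<close> must allow for the eigenvariables of both premises: those of
  \<open>\<rho>\<^sub>1\<close> may be in scope at the call, those of \<open>\<rho>\<^sub>0\<close>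
  come afterwards.\<close>

lemma abstr_realizes:
  assumes adm: "admissible \<rho>\<^sub>0 \<theta> \<theta>' W" and disj: "eigenvars \<rho>\<^sub>0 \<inter> eigenvars \<rho>\<^sub>1 = {}"
    and rl: "realize c \<theta>' W (eigenvars \<rho>\<^sub>0 \<union> eigenvars \<rho>\<^sub>1) \<Gamma> zx xs" and F: "not_ex F"
  shows "realizes c \<theta>' W (eigenvars \<rho>\<^sub>1) (dual F) (abstr F \<rho>\<^sub>0 zx) (cut_val c F \<rho>\<^sub>0 \<Gamma> \<theta> xs)"
proof (cases "n_ex F = 0")
  case True
  then show ?thesis using not_ex_is_sigma2_dual[OF F]
    by (auto simp: abstr_def tau_eps cut_val_def arity_def intro!: realizes_singleton_val yields_Unit)
next
  case False
  then have ar: "arity (dual F) = n_all F" using not_ex_is_sigma2_dual[OF F] by (simp add: arity_def)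
  show ?thesis unfolding realizes_def
  proof (intro allI impI ballI, goal_cases)
    case (1 \<theta>1 W1 ts us)
    let ?s = "map (env_tm \<theta>1 \<circ> eval_tm) ts"
    have us: "us \<in> denote c \<rho>\<^sub>0 (F # \<Gamma>) \<theta> 0 (singleton_val ?s # xs)"
      using 1(3) False by (simp add: cut_val_def)
    \<comment> \<open>The later world adds only eigenvariables of \<open>\<rho>\<^sub>1\<close>,
      none of which \<open>\<rho>\<^sub>0\<close> binds.\<close>
    have "admissible \<rho>\<^sub>0 \<theta> \<theta>1 W1"
      unfolding admissible_def
    proof (intro conjI ballI)
      show "env_wf \<theta>1" "fv_proof \<rho>\<^sub>0 - eigenvars \<rho>\<^sub>0 \<subseteq> W1" "W1 \<inter> eigenvars \<rho>\<^sub>0 = {}"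
        using adm 1(1) disj by (auto simp: admissible_def extends_def)
      fix a assume "a \<in> fv_proof \<rho>\<^sub>0 - eigenvars \<rho>\<^sub>0"
      then show "\<theta>1 a = \<theta> a" using adm 1(1) by (simp add: admissible_def extends_def subset_iff)
    qed
    moreover have "realizes c \<theta>1 W1 (eigenvars \<rho>\<^sub>0) F (tuple ts) (singleton_val ?s)"
      using 1(2) not_ex_is_sigma2[OF F] by (intro realizes_singleton_val yields_tuple) (auto simp: arity_def)
    moreover have "realize c \<theta>1 W1 (eigenvars \<rho>\<^sub>0) \<Gamma> zx xs"
      using rl by (rule realize_mono) (use 1(1) in \<open>auto simp: extends_def\<close>)
    ultimately have "yields c \<theta>1 W1 (apps (NT \<rho>\<^sub>0 0) (tuple ts # zx)) us"
      using denD[OF us] by (simp del: apps_simps)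
    moreover have "steps c (apps (abstr F \<rho>\<^sub>0 zx) ts) (apps (NT \<rho>\<^sub>0 0) (tuple ts # zx))"
      using steps_Lams_tuple[of ts "[]" c \<rho>\<^sub>0 zx] 1(2) False ar
      by (simp add: abstr_def tau_eps Let_def del: apps_simps)
    ultimately show ?case by (rule yields_steps[rotated])
  qed
qed

lemma compose_not_ex: "not_ex F \<Longrightarrow> compose F \<rho>\<^sub>0 \<rho>\<^sub>1 xs ys = abstr F \<rho>\<^sub>0 xs"
  by (erule not_ex_cases, simp add: compose_def)
    (cases F; simp add: compose_def abstr_def tau_eps)

lemma compose_realizes:
  assumes F: "not_ex F" and s: "s \<in> denote c \<rho>\<^sub>1 (dual F # \<Delta>) \<theta> 0 (cut_val c F \<rho>\<^sub>0 \<Gamma> \<theta> xs # ys)"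
    and witness: "witness (dual F) s"
    and adm: "admissible \<rho>\<^sub>0 \<theta> \<theta>' W" "admissible \<rho>\<^sub>1 \<theta> \<theta>' W"
    and disj: "eigenvars \<rho>\<^sub>0 \<inter> eigenvars \<rho>\<^sub>1 = {}"
    and rl: "realize c \<theta>' W (eigenvars \<rho>\<^sub>0 \<union> eigenvars \<rho>\<^sub>1) \<Gamma> zx xs"
      "realize c \<theta>' W (eigenvars \<rho>\<^sub>1) \<Delta> zy ys"
  shows "realizes c \<theta>' W E F (compose (dual F) \<rho>\<^sub>1 \<rho>\<^sub>0 zy zx) (singleton_val s)"
proof (rule realizes_singleton_val)
  show "arity F = 0" using not_ex_is_sigma2[OF F] by (simp add: arity_def)
  show "yields c \<theta>' W (compose (dual F) \<rho>\<^sub>1 \<rho>\<^sub>0 zy zx) s"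
    using F
  proof (cases rule: not_ex_cases)
    case (1 A)
    have "yields c \<theta>' W (apps (NT \<rho>\<^sub>1 0) (abstr F \<rho>\<^sub>0 zx # zy)) s"
      using abstr_realizes[OF adm(1) disj rl(1) F] rl(2)
      by (intro denD[OF s adm(2)]) simp
    then show ?thesis using 1 by (simp add: compose_def)
  next
    case 2
    then have "s = []" using witness by (simp add: witness_qfree)
    moreover have "compose (dual F) \<rho>\<^sub>1 \<rho>\<^sub>0 zy zx = Unit" using 2 by (cases F) (auto simp: compose_def)
    ultimately show ?thesis by (simp add: yields_Unit)
  qed
qed

lemma sound_Cut:
  assumes der: "\<rho>\<^sub>0 \<turnstile> A # \<Gamma>" "\<rho>\<^sub>1 \<turnstile> dual A # \<Delta>"
    and IH: "sound c \<rho>\<^sub>0 (A # \<Gamma>)" "sound c \<rho>\<^sub>1 (dual A # \<Delta>)"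
    and pnx: "prenex2 A" and reg: "regular (Cut A \<rho>\<^sub>0 \<rho>\<^sub>1)"
  shows "sound c (Cut A \<rho>\<^sub>0 \<rho>\<^sub>1) (\<Gamma> @ \<Delta>)"
proof -
  let ?\<rho> = "Cut A \<rho>\<^sub>0 \<rho>\<^sub>1"
  note premise_of = premise_of_rules(8,9)[OF reg]
  have disj: "eigenvars \<rho>\<^sub>0 \<inter> eigenvars \<rho>\<^sub>1 = {}" "eigenvars \<rho>\<^sub>1 \<inter> eigenvars \<rho>\<^sub>0 = {}"
    using reg eigenvars_fv_proof[of \<rho>\<^sub>0] eigenvars_fv_proof[of \<rho>\<^sub>1] by auto
  \<comment> \<open>Any value realized by the composition may stand for the cut formula; which value
    it is depends on the orientation of the cut and is left open as \<open>e\<close>.\<close>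
  have denL: "us \<in> denote c ?\<rho> (\<Gamma> @ \<Delta>) \<theta> i (xs @ ys)"
    if us: "us \<in> denote c \<rho>\<^sub>0 (A # \<Gamma>) \<theta> (Suc i) (e # xs)" and i: "i < length \<Gamma>"
      and len: "length xs = length \<Gamma>"
      and e: "\<And>\<theta>' W zx zy. admissible \<rho>\<^sub>0 \<theta> \<theta>' W \<Longrightarrow> admissible \<rho>\<^sub>1 \<theta> \<theta>' W \<Longrightarrow>
        realize c \<theta>' W (eigenvars \<rho>\<^sub>0 \<union> eigenvars \<rho>\<^sub>1) \<Gamma> zx xs \<Longrightarrow>
        realize c \<theta>' W (eigenvars \<rho>\<^sub>0 \<union> eigenvars \<rho>\<^sub>1) \<Delta> zy ys \<Longrightarrow>
        realizes c \<theta>' W (eigenvars \<rho>\<^sub>0) A (compose (dual A) \<rho>\<^sub>1 \<rho>\<^sub>0 zy zx) e"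
    for us \<theta> i xs ys e
  proof (rule denI)
    fix \<theta>' W zs
    assume adm: "admissible ?\<rho> \<theta> \<theta>' W"
      and rl: "realize c \<theta>' W (eigenvars ?\<rho>) (\<Gamma> @ \<Delta>) zs (xs @ ys)"
    note adm' = premise_of_admissible[OF premise_of(1) adm] premise_of_admissible[OF premise_of(2) adm]
    obtain zx zy where z: "zs = zx @ zy" "realize c \<theta>' W (eigenvars \<rho>\<^sub>0 \<union> eigenvars \<rho>\<^sub>1) \<Gamma> zx xs"
      "realize c \<theta>' W (eigenvars \<rho>\<^sub>0 \<union> eigenvars \<rho>\<^sub>1) \<Delta> zy ys"
      using rl len by (auto simp: realize_append)
    have "realize c \<theta>' W (eigenvars \<rho>\<^sub>0) \<Gamma> zx xs"
      using premise_of_realize[OF premise_of(1) admissible_env[OF adm], of c W \<Gamma> zx xs] z(2) by simp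
    then have "yields c \<theta>' W (apps (NT \<rho>\<^sub>0 (i + 1)) (compose (dual A) \<rho>\<^sub>1 \<rho>\<^sub>0 zy zx # zx)) us"
      using denD[OF us adm'(1)] e[OF adm' z(2,3)] by (simp del: apps_simps)
    moreover have "length zx = length \<Gamma>" "length zy = length \<Delta>"
      using realize_length[OF z(2)] realize_length[OF z(3)] by simp_all
    ultimately show "yields c \<theta>' W (apps (NT ?\<rho> i) zs) us"
      unfolding z(1) using i by (intro yields_production[OF production.Cut_left[OF der]])
  qed
  have denR: "us \<in> denote c ?\<rho> (\<Gamma> @ \<Delta>) \<theta> (length \<Gamma> + i) (xs @ ys)"
    if us: "us \<in> denote c \<rho>\<^sub>1 (dual A # \<Delta>) \<theta> (Suc i) (e # ys)" and i: "i < length \<Delta>"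
      and len: "length xs = length \<Gamma>"
      and e: "\<And>\<theta>' W zx zy. admissible \<rho>\<^sub>0 \<theta> \<theta>' W \<Longrightarrow> admissible \<rho>\<^sub>1 \<theta> \<theta>' W \<Longrightarrow>
        realize c \<theta>' W (eigenvars \<rho>\<^sub>0 \<union> eigenvars \<rho>\<^sub>1) \<Gamma> zx xs \<Longrightarrow>
        realize c \<theta>' W (eigenvars \<rho>\<^sub>0 \<union> eigenvars \<rho>\<^sub>1) \<Delta> zy ys \<Longrightarrow>
        realizes c \<theta>' W (eigenvars \<rho>\<^sub>1) (dual A) (compose A \<rho>\<^sub>0 \<rho>\<^sub>1 zx zy) e"
    for us \<theta> i xs ys e
  proof (rule denI)
    fix \<theta>' W zs
    assume adm: "admissible ?\<rho> \<theta> \<theta>' W"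
      and rl: "realize c \<theta>' W (eigenvars ?\<rho>) (\<Gamma> @ \<Delta>) zs (xs @ ys)"
    note adm' = premise_of_admissible[OF premise_of(1) adm] premise_of_admissible[OF premise_of(2) adm]
    obtain zx zy where z: "zs = zx @ zy" "realize c \<theta>' W (eigenvars \<rho>\<^sub>0 \<union> eigenvars \<rho>\<^sub>1) \<Gamma> zx xs"
      "realize c \<theta>' W (eigenvars \<rho>\<^sub>0 \<union> eigenvars \<rho>\<^sub>1) \<Delta> zy ys"
      using rl len by (auto simp: realize_append)
    have "realize c \<theta>' W (eigenvars \<rho>\<^sub>1) \<Delta> zy ys"
      using premise_of_realize[OF premise_of(2) admissible_env[OF adm], of c W \<Delta> zy ys] z(3) by simp
    then have "yields c \<theta>' W
        (apps (NT \<rho>\<^sub>1 (length \<Gamma> + i - length \<Gamma> + 1)) (compose A \<rho>\<^sub>0 \<rho>\<^sub>1 zx zy # zy)) us"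
      using denD[OF us adm'(2)] e[OF adm' z(2,3)] by (simp del: apps_simps)
    moreover have "length zx = length \<Gamma>" "length zy = length \<Delta>"
      using realize_length[OF z(2)] realize_length[OF z(3)] by simp_all
    ultimately show "yields c \<theta>' W (apps (NT ?\<rho> (length \<Gamma> + i)) zs) us"
      unfolding z(1) using i by (intro yields_production[OF production.Cut_right[OF der]]) simp_all
  qed
  have main: "(\<forall>i<length \<Gamma>. \<exists>us\<in>denote c ?\<rho> (\<Gamma> @ \<Delta>) \<theta> i (xs @ ys). witness (\<Gamma> ! i) us) \<and>
      (\<forall>i<length \<Delta>. \<exists>us\<in>denote c ?\<rho> (\<Gamma> @ \<Delta>) \<theta> (length \<Gamma> + i) (xs @ ys). witness (\<Delta> ! i) us) \<and>
      (\<forall>v. (\<exists>i<length \<Gamma>. \<exists>us\<in>denote c ?\<rho> (\<Gamma> @ \<Delta>) \<theta> i (xs @ ys). wins v (env_fm \<theta> (\<Gamma> ! i)) (xs ! i) us) \<or>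
        (\<exists>i<length \<Delta>. \<exists>us\<in>denote c ?\<rho> (\<Gamma> @ \<Delta>) \<theta> (length \<Gamma> + i) (xs @ ys).
          wins v (env_fm \<theta> (\<Delta> ! i)) (ys ! i) us))"
    if env: "env_wf \<theta>" and oks: "list_all2 counter \<Gamma> xs" "list_all2 counter \<Delta> ys" for \<theta> xs ys
  proof -
    have len: "length xs = length \<Gamma>" using list_all2_lengthD[OF oks(1)] by simp
    show ?thesis
    proof (cases "\<exists>B. A = Exists B")
      case False
      then have F: "not_ex A" using pnx by (auto simp: not_ex_def)
      define D where "D = {s \<in> denote c \<rho>\<^sub>1 (dual A # \<Delta>) \<theta> 0 (cut_val c A \<rho>\<^sub>0 \<Gamma> \<theta> xs # ys). witness (dual A) s}"
      have L: "us \<in> denote c ?\<rho> (\<Gamma> @ \<Delta>) \<theta> i (xs @ ys)"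
        if us: "us \<in> denote c \<rho>\<^sub>0 (A # \<Gamma>) \<theta> (Suc i) (singleton_val s # xs)" and s: "s \<in> D"
          and i: "i < length \<Gamma>" for us s i
      proof (rule denL[OF us i len])
        fix \<theta>' W zx zy
        assume *: "admissible \<rho>\<^sub>0 \<theta> \<theta>' W" "admissible \<rho>\<^sub>1 \<theta> \<theta>' W"
          "realize c \<theta>' W (eigenvars \<rho>\<^sub>0 \<union> eigenvars \<rho>\<^sub>1) \<Gamma> zx xs"
          "realize c \<theta>' W (eigenvars \<rho>\<^sub>0 \<union> eigenvars \<rho>\<^sub>1) \<Delta> zy ys"
        have "realize c \<theta>' W (eigenvars \<rho>\<^sub>1) \<Delta> zy ys"
          using *(4) by (rule realize_mono) (auto intro: extends_refl admissible_env[OF *(1)])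
        then show "realizes c \<theta>' W (eigenvars \<rho>\<^sub>0) A (compose (dual A) \<rho>\<^sub>1 \<rho>\<^sub>0 zy zx) (singleton_val s)"
          using s unfolding D_def by (intro compose_realizes[OF F _ _ *(1,2) disj(1) *(3)]) auto
      qed
      have R: "us \<in> denote c ?\<rho> (\<Gamma> @ \<Delta>) \<theta> (length \<Gamma> + i) (xs @ ys)"
        if us: "us \<in> denote c \<rho>\<^sub>1 (dual A # \<Delta>) \<theta> (Suc i) (cut_val c A \<rho>\<^sub>0 \<Gamma> \<theta> xs # ys)"
          and i: "i < length \<Delta>" for us i
        using us i len
        by (rule denR) (simp add: compose_not_ex[OF F] abstr_realizes[OF _ disj(1) _ F])
      note sem = cut_semantics[OF IH F env oks D_def]
      show ?thesis using sem L R by meson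
    next
      case True
      \<comment> \<open>The premises exchange roles: now \<open>\<rho>\<^sub>1\<close> proves the
        formula without a leading existential quantifier.\<close>
      then have F: "not_ex (dual A)" using prenex2_dual[OF pnx] by (auto simp: not_ex_def)
      define D where "D = {s \<in> denote c \<rho>\<^sub>0 (dual (dual A) # \<Gamma>) \<theta> 0 (cut_val c (dual A) \<rho>\<^sub>1 \<Delta> \<theta> ys # xs).
        witness (dual (dual A)) s}"
      have R: "us \<in> denote c ?\<rho> (\<Gamma> @ \<Delta>) \<theta> (length \<Gamma> + i) (xs @ ys)"
        if us: "us \<in> denote c \<rho>\<^sub>1 (dual A # \<Delta>) \<theta> (Suc i) (singleton_val s # ys)" and s: "s \<in> D"
          and i: "i < length \<Delta>" for us s i
      proof (rule denR[OF us i len])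
        fix \<theta>' W zx zy
        assume *: "admissible \<rho>\<^sub>0 \<theta> \<theta>' W" "admissible \<rho>\<^sub>1 \<theta> \<theta>' W"
          "realize c \<theta>' W (eigenvars \<rho>\<^sub>0 \<union> eigenvars \<rho>\<^sub>1) \<Gamma> zx xs"
          "realize c \<theta>' W (eigenvars \<rho>\<^sub>0 \<union> eigenvars \<rho>\<^sub>1) \<Delta> zy ys"
        have "realize c \<theta>' W (eigenvars \<rho>\<^sub>0) \<Gamma> zx xs"
          using *(3) by (rule realize_mono) (auto intro: extends_refl admissible_env[OF *(1)])
        then have "realizes c \<theta>' W (eigenvars \<rho>\<^sub>1) (dual A) (compose (dual (dual A)) \<rho>\<^sub>0 \<rho>\<^sub>1 zx zy) (singleton_val s)"
          using s *(4) unfolding D_def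
          by (intro compose_realizes[OF F _ _ *(2,1) disj(2)]) (auto simp: Un_commute)
        then show "realizes c \<theta>' W (eigenvars \<rho>\<^sub>1) (dual A) (compose A \<rho>\<^sub>0 \<rho>\<^sub>1 zx zy) (singleton_val s)"
          by simp
      qed
      have L: "us \<in> denote c ?\<rho> (\<Gamma> @ \<Delta>) \<theta> i (xs @ ys)"
        if us: "us \<in> denote c \<rho>\<^sub>0 (A # \<Gamma>) \<theta> (Suc i) (cut_val c (dual A) \<rho>\<^sub>1 \<Delta> \<theta> ys # xs)"
          and i: "i < length \<Gamma>" for us i
      proof (rule denL[OF us i len])
        fix \<theta>' W zx zy
        assume *: "admissible \<rho>\<^sub>0 \<theta> \<theta>' W" "admissible \<rho>\<^sub>1 \<theta> \<theta>' W"
          "realize c \<theta>' W (eigenvars \<rho>\<^sub>0 \<union> eigenvars \<rho>\<^sub>1) \<Gamma> zx xs"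
          "realize c \<theta>' W (eigenvars \<rho>\<^sub>0 \<union> eigenvars \<rho>\<^sub>1) \<Delta> zy ys"
        then show "realizes c \<theta>' W (eigenvars \<rho>\<^sub>0) A (compose (dual A) \<rho>\<^sub>1 \<rho>\<^sub>0 zy zx)
            (cut_val c (dual A) \<rho>\<^sub>1 \<Delta> \<theta> ys)"
          using abstr_realizes[OF *(2) disj(2) _ F, of c \<Delta> zy ys]
          by (simp add: compose_not_ex[OF F] Un_commute)
      qed
      have IH0: "sound c \<rho>\<^sub>0 (dual (dual A) # \<Gamma>)" using IH(1) by simp
      note sem = cut_semantics[OF IH(2) IH0 F env oks(2,1) D_def, unfolded dual_dual]
      show ?thesis using sem L R by meson
    qed
  qed
  show ?thesis
  proof (rule soundI)
    fix \<theta> :: "nat \<Rightarrow> 'a tm" and ds0 :: "'a val list"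
    assume env: "env_wf \<theta>" and "list_all2 counter (\<Gamma> @ \<Delta>) ds0"
    then obtain xs ys where ds: "ds0 = xs @ ys" "list_all2 counter \<Gamma> xs" "list_all2 counter \<Delta> ys"
      by (auto simp: list_all2_append1)
    note len = list_all2_lengthD[OF ds(2), symmetric]
    note main' = main[OF env ds(2,3)]
    show "total c ?\<rho> (\<Gamma> @ \<Delta>) \<theta> ds0"
    proof (rule totalI)
      fix i assume "i < length (\<Gamma> @ \<Delta>)"
      then show "\<exists>us\<in>denote c ?\<rho> (\<Gamma> @ \<Delta>) \<theta> i ds0. witness ((\<Gamma> @ \<Delta>) ! i) us"
        by (rule index_append) (use main' ds(1) in \<open>auto simp: nth_append\<close>)
    qed
    show "winning c ?\<rho> (\<Gamma> @ \<Delta>) \<theta> ds0"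
    proof (rule winningI)
      fix v
      from main' consider
        i us where "i < length \<Gamma>" "us \<in> denote c ?\<rho> (\<Gamma> @ \<Delta>) \<theta> i ds0" "wins v (env_fm \<theta> (\<Gamma> ! i)) (xs ! i) us"
        | i us where "i < length \<Delta>" "us \<in> denote c ?\<rho> (\<Gamma> @ \<Delta>) \<theta> (length \<Gamma> + i) ds0"
          "wins v (env_fm \<theta> (\<Delta> ! i)) (ys ! i) us"
        unfolding ds(1) by meson
      then show "\<exists>i<length (\<Gamma> @ \<Delta>). \<exists>us\<in>denote c ?\<rho> (\<Gamma> @ \<Delta>) \<theta> i ds0.
        wins v (env_fm \<theta> ((\<Gamma> @ \<Delta>) ! i)) (ds0 ! i) us"
      proof cases
        case (1 i us)
        then show ?thesis using ds(1) len by (intro exI[of _ i]) (auto simp: nth_append)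
      next
        case (2 i us)
        then show ?thesis using ds(1) len by (intro exI[of _ "length \<Gamma> + i"]) (auto simp: nth_append)
      qed
    qed
  qed
qed

theorem soundness:
  assumes "\<pi> \<turnstile> \<Gamma>" "regular \<pi>" "\<forall>F\<in>set \<Gamma>. prenex2 F" "\<forall>F\<in>cut_formulas \<pi>. prenex2 F"
  shows "sound c \<pi> \<Gamma>"
  using assms
proof (induction rule: proves.induct)
  case (Ax ts p)
  show ?case by (rule sound_Ax)
next
  case (OrI \<rho> A B \<Gamma>)
  have "qfree A \<and> qfree B" using OrI.prems(2) by (intro prenex2_Or) simp
  then have "prenex2 A" "prenex2 B" using qfree_prenex2 by blast+
  with OrI show ?case by (intro sound_OrI) auto
next
  case (AndI \<rho>\<^sub>0 A \<Gamma> \<rho>\<^sub>1 B \<Delta>)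
  have "qfree A \<and> qfree B" using AndI.prems(2) by (intro prenex2_And) simp
  then have "prenex2 A" "prenex2 B" using qfree_prenex2 by blast+
  with AndI show ?case by (intro sound_AndI) auto
next
  case (AllI \<rho> \<alpha> A \<Gamma>)
  have "prenex2 (inst 0 (Free \<alpha>) A)"
    using AllI.prems(2) by (auto intro!: prenex2_inst[OF prenex2_Forall(1)])
  with AllI show ?case by (intro sound_AllI proves.AllI) auto
next
  case (ExI \<rho> r A \<Gamma>)
  have "prenex2 (inst 0 r A)"
    using ExI.prems(2) by (auto intro!: prenex2_inst[OF prenex2_Exists])
  with ExI show ?case by (intro sound_ExI proves.ExI) auto
next
  case (Cut \<rho>\<^sub>0 A \<Gamma> \<rho>\<^sub>1 \<Delta>)
  then show ?case by (intro sound_Cut) auto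
next
  case (Weak \<rho> \<Gamma> A)
  then show ?case by (intro sound_Weak) auto
next
  case (Contr \<rho> A \<Gamma>)
  then show ?case by (intro sound_Contr) auto
next
  case (Perm \<rho> \<Gamma> B A \<Delta>)
  then show ?case by (intro sound_Perm) auto
qed

lemma sigma1_n_all: "sigma1 F \<Longrightarrow> n_all F = 0"
  by (auto simp: sigma1_def dest: qfree_counts)

theorem theorem2:
  fixes c :: 'f and \<pi> :: "('f, 'p) lkproof" and \<Gamma> :: "('f, 'p) fm list"
  assumes "\<pi> \<turnstile> \<Gamma>"
    and "regular \<pi>"
    and "\<forall>F\<in>set \<Gamma>. sigma1 F"
    and "\<forall>F\<in>cut_formulas \<pi>. pi2 F \<or> sigma2 F"
  shows "tautology (expansion \<Gamma> (lang c \<pi>))"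
proof -
  let ?n = "length \<Gamma>" and ?W = "fv_proof \<pi> - eigenvars \<pi>"
  \<comment> \<open>A Sigma_1 formula has no universal quantifiers, so the empty sequence is its
    counter-witness, and \<open>Unit\<close> realizes it.\<close>
  let ?ds = "replicate ?n (singleton_val [] :: 'f val)"
  have sound: "sound c \<pi> \<Gamma>"
    using assms sigma1_prenex2 by (intro soundness) (auto simp: prenex2_def)
  have n_all: "n_all F = 0" if "F \<in> set \<Gamma>" for F
    using that assms(3) sigma1_n_all by blast
  then have counter: "counter F (singleton_val [])" and ar: "arity F = 0" if "F \<in> set \<Gamma>" for F
    using that by (auto intro!: counter_singleton_val simp: is_sigma2_def witness_def arity_def)
  have "list_all2 counter \<Gamma> ?ds" using counter by (auto simp: list_all2_conv_all_nth)
  note win = soundD(2)[OF sound env_wf_Free this]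
  have rl: "realize c Free ?W (eigenvars \<pi>) \<Gamma> (replicate ?n Unit) ?ds"
    using ar by (induction \<Gamma>) (auto intro: realizes_singleton_val yields_Unit)
  \<comment> \<open>In the identity environment \<open>Free\<close> the value of a derived term is
    the term itself, so winning sequences are literally members of the language.\<close>
  have adm: "admissible \<pi> Free Free ?W"
    by (auto simp: admissible_def env_wf_Free)
  show ?thesis unfolding tautology_def
  proof
    fix v
    obtain i us where i: "i < ?n" "us \<in> denote c \<pi> \<Gamma> Free i ?ds" "wins v (env_fm Free (\<Gamma> ! i)) (?ds ! i) us"
      by (rule winningD[OF win])
    have na: "n_all (\<Gamma> ! i) = 0" by (rule n_all[OF nth_mem[OF i(1)]])
    obtain T where T: "steps c (apps (NT \<pi> i) (replicate ?n Unit)) T" "seqterm (length us) T"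
      "map (env_tm Free) (eval_seq T) = us"
      using denD[OF i(2) adm rl] by (rule yieldsE)
    have us: "length us = n_ex (\<Gamma> ! i)" "eval_seq T = us"
      using wins_witness[OF i(3)] T(3) by (auto simp: witness_def map_idI)
    have "(i, us) \<in> lang c \<pi>"
      unfolding lang_def using T us i(1) assms(1) by auto
    moreover have "holds v (instance_of (\<Gamma> ! i) us)"
      using i na by (simp add: wins_def is_sigma2_def full_inst_instance_of)
    ultimately show "\<exists>D\<in>set (expansion \<Gamma> (lang c \<pi>)). \<exists>A\<in>D. holds v A"
      using i(1)
      by (intro bexI[of _ "{instance_of (\<Gamma> ! i) ts | ts. (i, ts) \<in> lang c \<pi>}"])
        (auto simp: expansion_def)
  qed
qed

end
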